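(* The equivariant elliptic genus $\Phi_0(\tau,z,x)=\mathrm{Ell}_{q,y}(\mathbb{C}^2;t)$ of $\mathbb{C}^2$, where $q=e^{2\pi i\tau}$, $y=e^{2\pi iz}$, $t=e^{2\pi ix}$, given by $$\Phi_0(\tau,z,x)=y^{-1}\prod_{n=1}^\infty\frac{(1-yq^{n-1}t)(1-y^{-1}q^nt^{-1})(1-yq^{n-1}t^{-1})(1-y^{-1}q^nt)}{(1-q^{n-1}t)(1-q^nt^{-1})(1-q^{n-1}t^{-1})(1-q^nt)},$$ is a weak Jacobi form of weight $0$ and matrix index $$L=\begin{pmatrix}1&0\\0&0\end{pmatrix}$$ with respect to the elliptic variables $\bm{w}=(z,x)$.
   Context: **Weak Jacobi forms of matrix index.** Let $L$ be a rational symmetric $r\times r$ matrix such that $2L$ is integral with even diagonal entries; $L$ is allowed to be degenerate. For $\bm{w},\bm{w}'\in\mathbb{C}^r$ put $\langle\bm{w},\bm{w}'\rangle=\bm{w}^TL\bm{w}'$ and $\mathcal{Q}(\bm{w})=\langle\bm{w},\bm{w}\rangle$. A weak Jacobi form of weight $k\in\mathbb{Z}$ and matrix index $L$ is a meromorphic function $\Phi:\mathfrak{H}\times\mathbb{C}^r\to\mathbb{C}$ ($\mathfrak{H}$ the upper half plane) satisfying $$\Phi\Big(\frac{a\tau+b}{c\tau+d},\frac{\bm{w}}{c\tau+d}\Big)=(c\tau+d)^k\exp\Big(\frac{2\pi ic\,\mathcal{Q}(\bm{w})}{c\tau+d}\Big)\Phi(\tau,\bm{w}),$$ $$\Phi(\tau,\bm{w}+\bm{\alpha}\tau+\bm{\mu})=\exp\big(-2\pi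 i\tau\mathcal{Q}(\bm{\alpha})-4\pi i\langle\bm{w},\bm{\alpha}\rangle\big)\Phi(\tau,\bm{w})$$ for all $\begin{pmatrix}a&b\\c&d\end{pmatrix}\in SL_2(\mathbb{Z})$ and $\bm{\alpha},\bm{\mu}\in\mathbb{Z}^r$, and admitting a Fourier expansion $\Phi(\tau,\bm{w})=\sum_{n\ge0}\sum_{\bm{\gamma}\in\mathbb{Z}^r}c(n,\bm{\gamma})q^n\zeta_1^{\gamma_1}\cdots\zeta_r^{\gamma_r}$ with $\zeta_i=e^{2\pi iw_i}$. For $\Phi_0$ (which has poles, e.g. at $t=1$) the Fourier expansion is taken in the region $|q|<|t|<1$. *)

theory Defs
  imports "HOL-Analysis.Analysis"
begin

definition jacobi_domain :: "(complex \<times> (complex ^ 'r)) set" where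
  "jacobi_domain = {\<tau>. Im \<tau> > 0} \<times> UNIV"

text \<open>Holomorphy in several variables: complex Frechet differentiability at every point
  of an open set, i.e. the real derivative exists and is complex linear.\<close>

definition holomorphic_several_on ::
  "(complex \<times> (complex ^ 'r) \<Rightarrow> complex) \<Rightarrow> (complex \<times> (complex ^ 'r)) set \<Rightarrow> bool" where
  "holomorphic_several_on f U \<longleftrightarrow> open U \<and>
     (\<forall>p\<in>U. \<exists>D. (f has_derivative D) (at p) \<and>
        (\<forall>s \<sigma> v. D (s * \<sigma>, s *s v) = s * D (\<sigma>, v)))"

text \<open>Meromorphy: locally a quotient of holomorphic functions whose denominator vanishes
  identically on no nonempty open subset. The values of \<open>f\<close> at zeros of the
  denominator are irrelevant, as in HOL-Complex_Analysis for one variable.\<close>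

definition meromorphic_several_on ::
  "(complex \<times> (complex ^ 'r) \<Rightarrow> complex) \<Rightarrow> (complex \<times> (complex ^ 'r)) set \<Rightarrow> bool" where
  "meromorphic_several_on f S \<longleftrightarrow>
     (\<forall>p\<in>S. \<exists>U g h. p \<in> U \<and> U \<subseteq> S \<and>
        holomorphic_several_on g U \<and> holomorphic_several_on h U \<and>
        interior {x \<in> U. h x = 0} = {} \<and>
        (\<forall>x\<in>U. h x \<noteq> 0 \<longrightarrow> f x = g x / h x))"

definition regular_at ::
  "(complex \<times> (complex ^ 'r) \<Rightarrow> complex) \<Rightarrow> complex \<times> (complex ^ 'r) \<Rightarrow> bool" where
  "regular_at f p \<longleftrightarrow> (\<exists>U. p \<in> U \<and> holomorphic_several_on f U)"

definition jacobi_index :: "rat ^ 'r ^ 'r \<Rightarrow> bool" where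
  "jacobi_index L \<longleftrightarrow> transpose L = L \<and>
     (\<forall>i j. 2 * L $ i $ j \<in> \<int>) \<and>
     (\<forall>i. \<exists>m::int. even m \<and> 2 * L $ i $ i = of_int m)"

definition index_form :: "rat ^ 'r ^ 'r \<Rightarrow> complex ^ 'r \<Rightarrow> complex ^ 'r \<Rightarrow> complex" where
  "index_form L w w' = (\<Sum>i\<in>UNIV. \<Sum>j\<in>UNIV. w $ i * of_rat (L $ i $ j) * w' $ j)"

definition index_quad :: "rat ^ 'r ^ 'r \<Rightarrow> complex ^ 'r \<Rightarrow> complex" where
  "index_quad L w = index_form L w w"

definition cvec_of_int :: "int ^ 'r \<Rightarrow> complex ^ 'r" where
  "cvec_of_int \<alpha> = (\<chi> i. of_int (\<alpha> $ i))"

text \<open>The transformation laws are identities between meromorphic functions: they are imposed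
  at all points where both sides are holomorphic, an open dense set for meromorphic
  \<open>\<Phi>\<close>. This keeps them independent of the values which a total function
  takes at its poles.\<close>

definition modular_law ::
  "int \<Rightarrow> rat ^ 'r ^ 'r \<Rightarrow> (complex \<times> (complex ^ 'r) \<Rightarrow> complex) \<Rightarrow> bool" where
  "modular_law k L \<Phi> \<longleftrightarrow>
     (\<forall>a b c d :: int. a * d - b * c = 1 \<longrightarrow>
       (\<forall>\<tau> w. Im \<tau> > 0 \<longrightarrow>
         (let j = of_int c * \<tau> + of_int d;
              p' = ((of_int a * \<tau> + of_int b) / j, (1 / j) *s w)
          in regular_at \<Phi> (\<tau>, w) \<longrightarrow> regular_at \<Phi> p' \<longrightarrow>
             \<Phi> p' = j powi k * exp (2 * of_real pi * \<i> * of_int c * index_quad L w / j)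
                      * \<Phi> (\<tau>, w))))"

definition elliptic_law ::
  "rat ^ 'r ^ 'r \<Rightarrow> (complex \<times> (complex ^ 'r) \<Rightarrow> complex) \<Rightarrow> bool" where
  "elliptic_law L \<Phi> \<longleftrightarrow>
     (\<forall>(\<alpha> :: int ^ 'r) (\<mu> :: int ^ 'r) \<tau> w. Im \<tau> > 0 \<longrightarrow>
       (let p' = (\<tau>, w + \<tau> *s cvec_of_int \<alpha> + cvec_of_int \<mu>)
        in regular_at \<Phi> (\<tau>, w) \<longrightarrow> regular_at \<Phi> p' \<longrightarrow>
           \<Phi> p' = exp (- 2 * of_real pi * \<i> * \<tau> * index_quad L (cvec_of_int \<alpha>)
                         - 4 * of_real pi * \<i> * index_form L w (cvec_of_int \<alpha>))
                    * \<Phi> (\<tau>, w)))"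

text \<open>For a function with poles the Fourier expansion depends on the region \<open>R\<close>
  in which it is taken; for a holomorphic \<open>\<Phi>\<close> one takes the whole domain.
  The sum is unconditional (equivalently, absolutely convergent).\<close>

definition fourier_expansion_on ::
  "(complex \<times> (complex ^ 'r)) set \<Rightarrow> (complex \<times> (complex ^ 'r) \<Rightarrow> complex) \<Rightarrow> bool" where
  "fourier_expansion_on R \<Phi> \<longleftrightarrow>
     open R \<and> connected R \<and> R \<noteq> {} \<and> R \<subseteq> jacobi_domain \<and>
     (\<exists>c :: nat \<Rightarrow> int ^ 'r \<Rightarrow> complex. \<forall>(\<tau>, w) \<in> R.
        ((\<lambda>(n, \<gamma>). c n \<gamma> * exp (2 * of_real pi * \<i> * \<tau>) ^ n
            * (\<Prod>i\<in>UNIV. exp (2 * of_real pi * \<i> * w $ i) powi (\<gamma> $ i)))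
          has_sum \<Phi> (\<tau>, w)) UNIV)"

definition weak_jacobi_form ::
  "int \<Rightarrow> rat ^ 'r ^ 'r \<Rightarrow> (complex \<times> (complex ^ 'r)) set \<Rightarrow>
     (complex \<times> (complex ^ 'r) \<Rightarrow> complex) \<Rightarrow> bool" where
  "weak_jacobi_form k L R \<Phi> \<longleftrightarrow>
     jacobi_index L \<and> meromorphic_several_on \<Phi> jacobi_domain \<and>
     modular_law k L \<Phi> \<and> elliptic_law L \<Phi> \<and> fourier_expansion_on R \<Phi>"

text \<open>The equivariant elliptic genus of the plane. The product index is shifted, so that
  \<open>n\<close> here is \<open>n - 1\<close> in the usual product over positive integers.
  At poles a factor is a division by zero, and the total function takes the value 0.\<close>

definition elliptic_genus_C2 :: "complex \<Rightarrow> complex \<Rightarrow> complex \<Rightarrow> complex" where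
  "elliptic_genus_C2 \<tau> z x =
     (let q = exp (2 * of_real pi * \<i> * \<tau>);
          y = exp (2 * of_real pi * \<i> * z);
          t = exp (2 * of_real pi * \<i> * x)
      in inverse y * prodinf (\<lambda>n.
           ((1 - y * q ^ n * t) * (1 - inverse y * q ^ Suc n * inverse t)
             * (1 - y * q ^ n * inverse t) * (1 - inverse y * q ^ Suc n * t))
         / ((1 - q ^ n * t) * (1 - q ^ Suc n * inverse t)
             * (1 - q ^ n * inverse t) * (1 - q ^ Suc n * t))))"

text \<open>The region \<open>|q| < |t| < 1\<close>, where the second elliptic variable is \<open>x\<close>.\<close>

definition expansion_region :: "(complex \<times> (complex ^ 2)) set" where
  "expansion_region = {(\<tau>, w). Im \<tau> > 0 \<and>
     norm (exp (2 * of_real pi * \<i> * \<tau>)) < norm (exp (2 * of_real pi * \<i> * w $ 2)) \<and>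
     norm (exp (2 * of_real pi * \<i> * w $ 2)) < 1}"

end

theory Submission
  imports Defs "HOL-Complex_Analysis.Cauchy_Integral_Formula"
begin

text \<open>
  Write \<open>E(u)\<close> for the product of all \<open>1 - u q\<^sup>n\<close> with \<open>n \<ge> 0\<close>. Up to an elementary exponential
  factor, \<open>E(exp(2\<pi>iz)) E(q exp(-2\<pi>iz))\<close> is the odd Jacobi theta function \<open>\<theta>(\<tau>, z)\<close>, and the
  elliptic genus is the quotient
  \<open>\<theta>(z + x) \<theta>(z - x) / (\<theta>(x) \<theta>(-x))\<close> (\<open>elliptic_genus_C2_eq_theta\<close>). Everything is
  read off from this formula and its factors \<open>E\<close>.

  Elliptic law. The recursion \<open>E(u) = (1 - u) E(uq)\<close> gives the quasi-periodicity of \<open>\<theta>\<close>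
  under \<open>\<int>\<tau> + \<int>\<close>, with an exponent quadratic in the translation (\<open>theta_shift\<close>). In the quotient
  the quadratic forms combine to
  \<open>(k + l)\<^sup>2/2 + (k - l)\<^sup>2/2 - l\<^sup>2/2 - l\<^sup>2/2 = k\<^sup>2\<close>, which is the index \<open>diag(1, 0)\<close>.

  Modular law. For a matrix in \<open>SL\<^sub>2(\<int>)\<close>, the function
  \<open>z \<mapsto> exp(-\<pi>i c z\<^sup>2 / (c\<tau> + d)) \<theta>((a\<tau> + b)/(c\<tau> + d), z/(c\<tau> + d))\<close> is entire, has the same
  quasi-periods as \<open>\<theta>(\<tau>, \<cdot>)\<close> and vanishes on the lattice \<open>\<int>\<tau> + \<int>\<close>, where \<open>\<theta>(\<tau>, \<cdot>)\<close> has its zeros, all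
  of them simple. The quotient of the two functions is entire and doubly periodic, hence constant by
  Liouville's theorem (\<open>theta_unique\<close>, \<open>theta_modular\<close>). The constant depends on \<open>\<tau>\<close> and
  contains the weight and the multiplier system of \<open>\<theta>\<close>; it occurs twice in the numerator and twice in
  the denominator, so it cancels. This is why the weight is 0 and why its value need not be computed.

  Meromorphy. The partial products converge locally uniformly in \<open>(q, u)\<close>, so \<open>E\<close> is continuous in
  both variables and holomorphic in each of them; by Osgood's lemma it is complex differentiable
  (\<open>osgood_has_derivative\<close>). The zeros of the denominator lie on \<open>x \<in> \<int>\<tau> + \<int>\<close>, which contains no
  open set.

  Fourier expansion. In the denominator, \<open>E(t) E(q/t) E(1/t) E(qt) = -t\<^sup>-\<^sup>1 E(t)\<^sup>2 E(q/t)\<^sup>2\<close>, and both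
  \<open>t\<close> and \<open>q/t\<close> have modulus less than 1 in the region. Euler's identities
  \<open>E(u) = \<Sum> (-1)\<^sup>n q\<^bsup>n(n-1)/2\<^esup> u\<^sup>n / ((1-q)\<cdots>(1-q\<^sup>n))\<close> and
  \<open>1/E(u) = \<Sum> u\<^sup>n / ((1-q)\<cdots>(1-q\<^sup>n))\<close> for \<open>|u| < 1\<close> then give an absolutely convergent
  expansion of each factor in monomials with nonnegative powers of \<open>q\<close>, and such expansions can be
  multiplied (\<open>expandable_on_mult\<close>).
\<close>

section \<open>The product of all 1 - uq^n\<close>

text \<open>
  The infinite \<open>q\<close>-Pochhammer symbol \<open>(u; q)\<^sub>\<infinity>\<close>.
\<close>

definition qpoch :: "complex \<Rightarrow> complex \<Rightarrow> complex" where
  "qpoch q u = (\<Prod>n. 1 - u * q ^ n)"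

lemma convergent_prod_qpoch:
  fixes q u :: complex
  assumes "norm q < 1"
  shows "convergent_prod (\<lambda>n. 1 - u * q ^ n)"
proof -
  have "summable (\<lambda>n. norm (- u * q ^ n))"
    unfolding norm_mult norm_power using assms by (intro summable_mult summable_geometric) auto
  hence "abs_convergent_prod (\<lambda>n. 1 + (- u * q ^ n))"
    by (intro summable_imp_abs_convergent_prod) auto
  thus ?thesis
    using abs_convergent_prod_imp_convergent_prod by fastforce
qed

lemma has_prod_qpoch:
  assumes "norm q < 1"
  shows "(\<lambda>n. 1 - u * q ^ n) has_prod qpoch q u"
  using convergent_prod_qpoch[OF assms] unfolding qpoch_def by (rule convergent_prod_has_prod)

lemma qpoch_eq_0_iff:
  assumes "norm q < 1"
  shows "qpoch q u = 0 \<longleftrightarrow> (\<exists>n. u * q ^ n = 1)"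
  using has_prod_eq_0_iff[OF has_prod_qpoch[OF assms], of u] by auto

lemma qpoch_rec:
  assumes "norm q < 1"
  shows "qpoch q u = (1 - u) * qpoch q (u * q)"
proof -
  have "(\<lambda>n. 1 - u * q ^ n) has_prod ((\<Prod>k<1. 1 - u * q ^ k) * (\<Prod>k. 1 - u * q ^ (k + 1)))"
    by (rule has_prod_ignore_initial_segment'[OF convergent_prod_qpoch[OF assms]])
  hence "qpoch q u = (1 - u) * (\<Prod>k. 1 - u * q ^ (k + 1))"
    using has_prod_unique2[OF has_prod_qpoch[OF assms]] by fastforce
  thus ?thesis by (simp add: qpoch_def mult_ac)
qed

text \<open>
  The terms are dominated by the geometric series of \<open>M r\<^sup>n\<close> on the whole product of discs. Uniformity in
  both variables at once yields the joint continuity that Osgood's lemma needs.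
\<close>

lemma uniform_limit_qpoch:
  assumes "0 \<le> r" "r < 1" "0 \<le> M"
  shows "uniform_limit (cball 0 r \<times> cball 0 M) (\<lambda>N p. \<Prod>n<N. 1 - snd p * fst p ^ n)
           (\<lambda>p. qpoch (fst p) (snd p)) sequentially"
proof -
  let ?A = "cball 0 r \<times> cball 0 M :: (complex \<times> complex) set"
  have "uniformly_convergent_on ?A (\<lambda>N p. \<Sum>n<N. norm ((1 - snd p * fst p ^ n) - 1))"
  proof (rule Weierstrass_m_test'[where M = "\<lambda>n. M * r ^ n"])
    show "norm (norm ((1 - snd p * fst p ^ n) - 1)) \<le> M * r ^ n" if "p \<in> ?A" for n p
      using that assms by (auto simp: norm_mult norm_power intro!: mult_mono power_mono)
    show "summable (\<lambda>n. M * r ^ n)"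
      using assms by (intro summable_mult summable_geometric) auto
  qed
  hence "uniformly_convergent_on ?A (\<lambda>N p. \<Prod>n<N. 1 - snd p * fst p ^ n)"
    by (intro uniformly_convergent_on_prod')
       (auto intro!: continuous_intros compact_Times)
  then obtain l where l: "uniform_limit ?A (\<lambda>N p. \<Prod>n<N. 1 - snd p * fst p ^ n) l sequentially"
    by (auto simp: uniformly_convergent_on_def)
  have "l p = qpoch (fst p) (snd p)" if "p \<in> ?A" for p
  proof -
    have "norm (fst p) < 1" using that assms by auto
    from has_prod_imp_tendsto'[OF has_prod_qpoch[OF this]] tendsto_uniform_limitI[OF l that]
    show ?thesis by (rule LIMSEQ_unique[rotated])
  qed
  with l show ?thesis
    by (metis (no_types, lifting) uniform_limit_cong')
qed

lemma qpoch_continuous_on: "continuous_on (ball 0 1 \<times> UNIV) (\<lambda>p. qpoch (fst p) (snd p))"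
proof -
  have "isCont (\<lambda>p. qpoch (fst p) (snd p)) p" if p: "p \<in> ball 0 1 \<times> UNIV" for p
  proof -
    from p have "norm (fst p) < 1" by auto
    then obtain r where r: "norm (fst p) < r" "r < 1" using dense by blast
    have r0: "0 \<le> r" using r norm_ge_zero[of "fst p"] by linarith
    have "continuous_on (cball 0 r \<times> cball 0 (norm (snd p) + 1)) (\<lambda>p. qpoch (fst p) (snd p))"
      by (rule uniform_limit_theorem[OF _ uniform_limit_qpoch])
         (use r r0 in \<open>auto intro!: always_eventually continuous_intros\<close>)
    hence "continuous_on (ball 0 r \<times> ball 0 (norm (snd p) + 1)) (\<lambda>p. qpoch (fst p) (snd p))"
      by (rule continuous_on_subset) auto
    moreover have "p \<in> ball 0 r \<times> ball 0 (norm (snd p) + 1)"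
      using r by (auto simp: mem_Times_iff)
    ultimately show ?thesis
      by (subst (asm) continuous_on_eq_continuous_at) (auto intro: open_Times)
  qed
  thus ?thesis by (simp add: continuous_at_imp_continuous_on)
qed

lemma qpoch_holomorphic_base: "(\<lambda>q. qpoch q u) holomorphic_on ball 0 1"
proof (rule holomorphic_uniform_sequence)
  show "(\<lambda>q. \<Prod>n<N. 1 - u * q ^ n) holomorphic_on ball 0 1" for N
    by (intro holomorphic_intros)
  fix x :: complex assume x: "x \<in> ball 0 1"
  hence "norm x < 1" by auto
  then obtain r where r: "norm x < r" "r < 1" using dense by blast
  have sub: "cball x (r - norm x) \<subseteq> cball 0 r"
    by (auto simp: dist_norm) (metis add.commute diff_add_cancel diff_le_eq le_diff_eq norm_minus_commute norm_triangle_sub order_trans)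
  have "uniform_limit (cball 0 r) (\<lambda>N q. \<Prod>n<N. 1 - u * q ^ n) (\<lambda>q. qpoch q u) sequentially"
    using uniform_limit_compose'[OF uniform_limit_qpoch[of r "norm u"], of "\<lambda>q. (q, u)" "cball 0 r"]
      r norm_ge_zero[of x] by auto
  with sub r show "\<exists>d>0. cball x d \<subseteq> ball 0 1 \<and>
      uniform_limit (cball x d) (\<lambda>N q. \<Prod>n<N. 1 - u * q ^ n) (\<lambda>q. qpoch q u) sequentially"
    by (intro exI[of _ "r - norm x"]) (auto intro: uniform_limit_on_subset)
qed auto

lemma qpoch_holomorphic_arg:
  assumes "norm q < 1"
  shows "qpoch q holomorphic_on UNIV"
proof (rule holomorphic_uniform_sequence)
  show "(\<lambda>u. \<Prod>n<N. 1 - u * q ^ n) holomorphic_on UNIV" for N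
    by (intro holomorphic_intros)
  fix x :: complex
  have sub: "cball x 1 \<subseteq> cball 0 (norm x + 1)"
    by (auto simp: dist_norm) (metis add.commute diff_le_eq norm_minus_commute norm_triangle_ineq2 order_trans)
  have "uniform_limit (cball 0 (norm x + 1)) (\<lambda>N u. \<Prod>n<N. 1 - u * q ^ n) (qpoch q) sequentially"
    using uniform_limit_compose'[OF uniform_limit_qpoch[of "norm q" "norm x + 1"],
        of "\<lambda>u. (q, u)" "cball 0 (norm x + 1)"] assms by auto
  with sub show "\<exists>d>0. cball x d \<subseteq> UNIV \<and>
      uniform_limit (cball x d) (\<lambda>N u. \<Prod>n<N. 1 - u * q ^ n) (qpoch q) sequentially"
    by (intro exI[of _ 1]) (auto intro: uniform_limit_on_subset)
qed auto

section \<open>Complex differentiability from separate holomorphy\<close>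

text \<open>
  Osgood's lemma. By compactness, \<open>f x'\<close> is uniformly close to \<open>f x\<close> on a closed disc when \<open>x'\<close>
  is close to \<open>x\<close>; Cauchy's inequality turns this into closeness of the derivatives in \<open>y\<close>. Hence the
  second partial derivative is jointly continuous, and a function with both partial derivatives, one of
  them continuous, is differentiable.
\<close>

lemma osgood_has_derivative:
  fixes f :: "complex \<Rightarrow> complex \<Rightarrow> complex"
  assumes op: "open A" "open B"
    and cont: "continuous_on (A \<times> B) (\<lambda>(x, y). f x y)"
    and hx: "\<And>y. y \<in> B \<Longrightarrow> (\<lambda>x. f x y) holomorphic_on A"
    and hy: "\<And>x. x \<in> A \<Longrightarrow> f x holomorphic_on B"
    and xy: "x \<in> A" "y \<in> B"
  shows "\<exists>a b. ((\<lambda>(x, y). f x y) has_derivative (\<lambda>(s, t). a * s + b * t)) (at (x, y))"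
proof -
  obtain R where R: "R > 0" "cball y R \<subseteq> B" using op xy by (meson open_contains_cball)
  define Y where "Y = ball y (R / 2)"
  have contY: "continuous_on (A \<times> cball y R) (\<lambda>(x, y). f x y)"
    by (rule continuous_on_subset[OF cont]) (use R in auto)
  have der_cont: "((\<lambda>p. deriv (f (fst p)) (snd p)) \<longlongrightarrow> deriv (f x) y) (at (x, y) within A \<times> Y)"
  proof (rule tendstoI)
    fix e :: real assume e: "e > 0"
    \<comment> \<open>Cauchy on a disc of radius \<open>R / 2\<close> divides \<open>e'\<close> by \<open>R / 2\<close>, which leaves \<open>e / 4\<close>.\<close>
    define e' where "e' = e * R / 8"
    have e': "e' > 0" using e R by (simp add: e'_def)
    obtain X0 where X0: "x \<in> X0" "open X0" "\<forall>x'\<in>X0 \<inter> A. \<forall>t\<in>cball y R. dist (f x' t) (f x t) \<le> e'"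
      using continuous_on_prod_compactE[OF contY _ \<open>x \<in> A\<close> e'] by auto
    have "continuous_on (ball y R) (deriv (f x))"
      using holomorphic_on_subset[OF hy[OF xy(1)] subset_trans[OF ball_subset_cball R(2)]]
      by (intro holomorphic_on_imp_continuous_on holomorphic_deriv) auto
    hence "isCont (deriv (f x)) y"
      using R by (simp add: continuous_on_eq_continuous_at)
    hence "((deriv (f x)) \<longlongrightarrow> deriv (f x) y) (nhds y)"
      unfolding isCont_def tendsto_at_iff_tendsto_nhds .
    hence "eventually (\<lambda>y'. dist (deriv (f x) y') (deriv (f x) y) < e / 2) (nhds y)"
      using e by (intro tendstoD) auto
    then obtain Y0 where Y0: "open Y0" "y \<in> Y0" "\<And>y'. y' \<in> Y0 \<Longrightarrow> dist (deriv (f x) y') (deriv (f x) y) < e / 2"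
      unfolding eventually_nhds by blast
    have "eventually (\<lambda>p. p \<in> X0 \<times> Y0) (nhds (x, y))"
      using X0 Y0 by (intro eventually_nhds_in_open) (auto intro: open_Times)
    hence "eventually (\<lambda>p. p \<in> X0 \<times> Y0 \<and> p \<in> A \<times> Y) (at (x, y) within A \<times> Y)"
      by (auto simp: eventually_at_filter elim!: eventually_mono)
    thus "eventually (\<lambda>p. dist (deriv (f (fst p)) (snd p)) (deriv (f x) y) < e) (at (x, y) within A \<times> Y)"
    proof eventually_elim
      case (elim p)
      obtain x' y' where p: "p = (x', y')" by fastforce
      have x': "x' \<in> X0" "x' \<in> A" and y': "y' \<in> Y0" "y' \<in> Y" using elim p by auto
      have sub: "cball y' (R / 2) \<subseteq> cball y R"
        using y' unfolding Y_def by (auto simp: dist_norm) (smt (verit) dist_commute dist_norm dist_triangle field_sum_of_halves)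
      have subB: "cball y' (R / 2) \<subseteq> B" using sub R by auto
      have y'B: "y' \<in> B" using subB R by auto
      have hol: "(\<lambda>t. f x' t - f x t) holomorphic_on cball y' (R / 2)"
        using hy[OF x'(2)] hy[OF xy(1)] subB by (auto intro!: holomorphic_intros intro: holomorphic_on_subset)
      have "norm ((deriv ^^ 1) (\<lambda>t. f x' t - f x t) y') \<le> fact 1 * e' / (R / 2) ^ 1"
      proof (rule Cauchy_inequality)
        show "(\<lambda>t. f x' t - f x t) holomorphic_on ball y' (R / 2)"
          using hol by (rule holomorphic_on_subset) auto
        show "continuous_on (cball y' (R / 2)) (\<lambda>t. f x' t - f x t)"
          using hol by (rule holomorphic_on_imp_continuous_on)
        show "norm (f x' t - f x t) \<le> e'" if "norm (y' - t) = R / 2" for t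
        proof -
          have "t \<in> cball y R" using that sub by (auto simp: dist_norm)
          thus ?thesis using X0(3) x' by (auto simp: dist_norm)
        qed
      qed (use R in auto)
      moreover have "deriv (\<lambda>t. f x' t - f x t) y' = deriv (f x') y' - deriv (f x) y'"
        using hy[OF x'(2)] hy[OF xy(1)] y'B op by (intro deriv_diff) (auto simp: holomorphic_on_imp_differentiable_at)
      ultimately have "dist (deriv (f x') y') (deriv (f x) y') \<le> e / 4"
        using R by (simp add: dist_norm e'_def field_simps)
      with Y0(3)[OF y'(1)] show ?case
        using p dist_triangle[of "deriv (f x') y'" "deriv (f x) y" "deriv (f x) y'"] e by simp
    qed
  qed
  define fy where "fy = (\<lambda>x y. blinfun_mult_right (deriv (f x) y))"
  have Ysub: "Y \<subseteq> B" "open Y" "y \<in> Y" "convex Y" using R by (auto simp: Y_def)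
  have "((\<lambda>(x, y). f x y) has_derivative (\<lambda>(s, t). deriv (\<lambda>x. f x y) x * s + fy x y t)) (at (x, y) within A \<times> Y)"
  proof (rule has_derivative_partialsI)
    show "((\<lambda>x. f x y) has_derivative (*) (deriv (\<lambda>x. f x y) x)) (at x within A)"
      using holomorphic_derivI[OF hx[OF xy(2)] op(1) xy(1)]
      by (auto simp: has_field_derivative_def intro: has_derivative_at_withinI)
    show "(f x' has_derivative blinfun_apply (fy x' y')) (at y' within Y)" if "x' \<in> A" "y' \<in> Y" for x' y'
      using holomorphic_derivI[OF hy[OF that(1)] op(2), of y'] that Ysub
      by (auto simp: has_field_derivative_def fy_def blinfun_mult_right.rep_eq intro: has_derivative_at_withinI)
    show "continuous (at (x, y) within A \<times> Y) (\<lambda>(x, y). fy x y)"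
      using der_cont unfolding continuous_within fy_def case_prod_unfold
      by (auto intro: bounded_linear.tendsto[OF bounded_linear_blinfun_mult_right])
  qed (use Ysub in auto)
  moreover have "at (x, y) within A \<times> Y = at (x, y)"
    using xy Ysub op by (intro at_within_open) (auto intro: open_Times)
  ultimately show ?thesis
    by (intro exI[of _ "deriv (\<lambda>x. f x y) x"] exI[of _ "deriv (f x) y"]) (simp add: fy_def blinfun_mult_right.rep_eq)
qed

lemma holomorphic_several_on_mult:
  assumes "holomorphic_several_on f U" "holomorphic_several_on g U"
  shows "holomorphic_several_on (\<lambda>p. f p * g p) U"
  unfolding holomorphic_several_on_def
proof (intro conjI ballI)
  show "open U" using assms by (simp add: holomorphic_several_on_def)
  fix p assume p: "p \<in> U"
  obtain D where D: "(f has_derivative D) (at p)" "\<And>s \<sigma> v. D (s * \<sigma>, s *s v) = s * D (\<sigma>, v)"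
    using assms(1) p unfolding holomorphic_several_on_def by blast
  obtain D' where D': "(g has_derivative D') (at p)" "\<And>s \<sigma> v. D' (s * \<sigma>, s *s v) = s * D' (\<sigma>, v)"
    using assms(2) p unfolding holomorphic_several_on_def by blast
  show "\<exists>D. ((\<lambda>p. f p * g p) has_derivative D) (at p) \<and> (\<forall>s \<sigma> v. D (s * \<sigma>, s *s v) = s * D (\<sigma>, v))"
    using has_derivative_mult[OF D(1) D'(1)]
    by (intro exI conjI) (auto simp: D(2) D'(2) algebra_simps)
qed

text \<open>
  The chain rule for substituting two holomorphic functions into a function of two variables to which Osgood's
  lemma applies.
\<close>

lemma holomorphic_several_on_compose:
  fixes F :: "complex \<Rightarrow> complex \<Rightarrow> complex"
  assumes A: "open A" and B: "open B" and cont: "continuous_on (A \<times> B) (\<lambda>(x, y). F x y)"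
    and hx: "\<And>y. y \<in> B \<Longrightarrow> (\<lambda>x. F x y) holomorphic_on A"
    and hy: "\<And>x. x \<in> A \<Longrightarrow> F x holomorphic_on B"
    and f: "holomorphic_several_on f U" "f ` U \<subseteq> A" and g: "holomorphic_several_on g U" "g ` U \<subseteq> B"
  shows "holomorphic_several_on (\<lambda>p. F (f p) (g p)) U"
  unfolding holomorphic_several_on_def
proof (intro conjI ballI)
  show "open U" using f by (simp add: holomorphic_several_on_def)
  fix p assume p: "p \<in> U"
  obtain D where D: "(f has_derivative D) (at p)" "\<And>s \<sigma> v. D (s * \<sigma>, s *s v) = s * D (\<sigma>, v)"
    using f(1) p unfolding holomorphic_several_on_def by blast
  obtain D' where D': "(g has_derivative D') (at p)" "\<And>s \<sigma> v. D' (s * \<sigma>, s *s v) = s * D' (\<sigma>, v)"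
    using g(1) p unfolding holomorphic_several_on_def by blast
  obtain a b where ab: "((\<lambda>(x, y). F x y) has_derivative (\<lambda>(s, t). a * s + b * t)) (at (f p, g p))"
    using osgood_has_derivative[OF A B cont hx hy, of "f p" "g p"] f(2) g(2) p by blast
  have "((\<lambda>p. (\<lambda>(x, y). F x y) (f p, g p)) has_derivative (\<lambda>h. (\<lambda>(s, t). a * s + b * t) (D h, D' h))) (at p)"
    by (rule has_derivative_compose[OF has_derivative_Pair[OF D(1) D'(1)] ab])
  thus "\<exists>D. ((\<lambda>p. F (f p) (g p)) has_derivative D) (at p) \<and> (\<forall>s \<sigma> v. D (s * \<sigma>, s *s v) = s * D (\<sigma>, v))"
    by (intro exI conjI) (auto simp: D(2) D'(2) algebra_simps)
qed

section \<open>The Jacobi theta function\<close>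

definition expi :: "complex \<Rightarrow> complex" where
  "expi z = exp (2 * of_real pi * \<i> * z)"

lemma expi_add: "expi (x + y) = expi x * expi y"
  by (simp add: expi_def ring_distribs exp_add)

lemma expi_minus: "expi (- x) = inverse (expi x)"
  by (simp add: expi_def exp_minus)

lemma expi_diff: "expi (x - y) = expi x / expi y"
  by (simp add: expi_def exp_diff right_diff_distrib)

lemma expi_nonzero [simp]: "expi x \<noteq> 0"
  by (simp add: expi_def)

lemma expi_of_nat_mult: "expi (of_nat n * x) = expi x ^ n"
  by (simp add: expi_def exp_of_nat_mult[symmetric] mult_ac)

lemma expi_eq_1_iff: "expi z = 1 \<longleftrightarrow> (\<exists>n::int. z = of_int n)"
proof -
  have "expi z = 1 \<longleftrightarrow> (\<exists>n::int. 2 * of_real pi * \<i> * z = 2 * of_real pi * \<i> * of_int n)"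
    unfolding expi_def exp_eq_1 by (auto simp: complex_eq_iff)
  thus ?thesis by simp
qed

lemma expi_of_int [simp]: "expi (of_int n) = 1"
  using expi_eq_1_iff by blast

lemma expi_0 [simp]: "expi 0 = 1"
  by (simp add: expi_def)

lemma expi_half: "expi (1 / 2) = - 1"
  by (simp add: expi_def)

lemma expi_odd_half:
  assumes "odd n"
  shows "expi (of_int n / 2) = - 1"
proof -
  from assms obtain k where "n = 2 * k + 1" by (elim oddE)
  hence "expi (of_int n / 2) = expi (of_int k + 1 / 2)" by (simp add: add_divide_distrib)
  thus ?thesis by (simp only: expi_add expi_half expi_of_int mult_1)
qed

lemma norm_expi: "norm (expi z) = exp (- 2 * pi * Im z)"
  by (simp add: expi_def)

lemma norm_expi_less_1 [simp]: "Im \<tau> > 0 \<Longrightarrow> norm (expi \<tau>) < 1"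
  by (simp add: norm_expi)

lemma expi_holomorphic [holomorphic_intros]:
  "f holomorphic_on A \<Longrightarrow> (\<lambda>z. expi (f z)) holomorphic_on A"
  unfolding expi_def by (intro holomorphic_intros)

text \<open>
  This is the odd Jacobi theta function \<open>\<theta>\<^sub>1\<close> divided by a nonzero function of \<open>\<tau>\<close> alone. The factor
  \<open>expi (- z / 2)\<close> makes the signs under \<open>z \<mapsto> z + 1\<close> and \<open>z \<mapsto> z + \<tau>\<close> agree.
\<close>

definition theta :: "complex \<Rightarrow> complex \<Rightarrow> complex" where
  "theta \<tau> z = expi (- z / 2) * (qpoch (expi \<tau>) (expi z) * qpoch (expi \<tau>) (expi (\<tau> - z)))"

lemma theta_plus_1: "theta \<tau> (z + 1) = - theta \<tau> z"
proof -
  have "expi (z + 1) = expi z" "expi (\<tau> - (z + 1)) = expi (\<tau> - z)"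
    using expi_of_int[of 1] by (simp_all add: expi_add expi_diff)
  moreover have "expi (- (z + 1) / 2) = - expi (- z / 2)"
  proof -
    have "expi (- (z + 1) / 2) = expi (- z / 2 - 1 / 2)"
      by (rule arg_cong[of _ _ expi]) (simp add: field_simps)
    thus ?thesis unfolding expi_diff expi_half by simp
  qed
  ultimately show ?thesis by (simp add: theta_def)
qed

text \<open>
  With \<open>u = expi z\<close>, the translation replaces \<open>E(u) E(q/u)\<close> by \<open>E(uq) E(1/u)\<close>. Taking the leading factor
  out of \<open>E(u)\<close> and of \<open>E(1/u)\<close> shows that the ratio of the two is \<open>(1 - 1/u) / (1 - u) = -1/u\<close>; the
  calculation avoids the division because \<open>u\<close> may be 1.
\<close>

lemma theta_plus_tau:
  assumes "Im \<tau> > 0"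
  shows "theta \<tau> (z + \<tau>) = - expi (- \<tau> / 2 - z) * theta \<tau> z"
proof -
  define u where "u = expi z"
  define q where "q = expi \<tau>"
  have q: "norm q < 1" using assms by (simp add: q_def)
  have u0: "u \<noteq> 0" by (simp add: u_def)
  have A: "qpoch q u = (1 - u) * qpoch q (u * q)" by (rule qpoch_rec[OF q])
  have B: "qpoch q (inverse u) = (1 - inverse u) * qpoch q (inverse u * q)" by (rule qpoch_rec[OF q])
  have 1: "(1 - inverse u) = - inverse u * (1 - u)" using u0 by (simp add: field_simps)
  have "theta \<tau> (z + \<tau>) = expi (- (z + \<tau>) / 2) * (qpoch q (u * q) * qpoch q (inverse u))"
    by (simp add: theta_def q_def u_def expi_add expi_minus)
  also have "\<dots> = expi (- (z + \<tau>) / 2) * (- inverse u) * (qpoch q u * qpoch q (inverse u * q))"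
    unfolding B A 1 by (simp add: mult_ac)
  also have "expi (- (z + \<tau>) / 2) * (- inverse u) = - expi (- \<tau> / 2 - z) * expi (- z / 2)"
  proof -
    have "expi (- (z + \<tau>) / 2 - z) = expi ((- \<tau> / 2 - z) + (- z / 2))"
      by (rule arg_cong[of _ _ expi]) (simp add: field_simps)
    thus ?thesis unfolding expi_add expi_diff[of _ z] u_def by (simp add: field_simps)
  qed
  also have "inverse u * q = expi (\<tau> - z)" by (simp add: u_def q_def expi_diff field_simps)
  finally show ?thesis by (simp add: theta_def q_def u_def mult_ac)
qed

lemma theta_plus_int_tau:
  assumes "Im \<tau> > 0"
  shows "theta \<tau> (z + of_int m * \<tau>) =
           expi (of_int m / 2 - of_int m ^ 2 * \<tau> / 2 - of_int m * z) * theta \<tau> z"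
proof (induction m rule: int_induct[where k = 0])
  case base
  show ?case by simp
next
  case (step1 m)
  have "theta \<tau> (z + of_int (m + 1) * \<tau>) = theta \<tau> ((z + of_int m * \<tau>) + \<tau>)"
    by (simp add: algebra_simps)
  also have "\<dots> = (expi (1 / 2) * expi (- \<tau> / 2 - (z + of_int m * \<tau>)) *
       expi (of_int m / 2 - of_int m ^ 2 * \<tau> / 2 - of_int m * z)) * theta \<tau> z"
    by (simp add: theta_plus_tau[OF assms] step1 expi_half)
  also have "expi (1 / 2) * expi (- \<tau> / 2 - (z + of_int m * \<tau>)) *
       expi (of_int m / 2 - of_int m ^ 2 * \<tau> / 2 - of_int m * z) =
      expi (of_int (m + 1) / 2 - of_int (m + 1) ^ 2 * \<tau> / 2 - of_int (m + 1) * z)"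
    unfolding expi_add[symmetric] by (rule arg_cong[of _ _ expi]) (simp add: field_simps power2_eq_square)
  finally show ?case .
next
  case (step2 m)
  let ?w = "z + of_int (m - 1) * \<tau>"
  have "theta \<tau> (z + of_int m * \<tau>) = theta \<tau> (?w + \<tau>)"
    by (simp add: algebra_simps)
  also have "\<dots> = (expi (1 / 2) * expi (- \<tau> / 2 - ?w)) * theta \<tau> ?w"
    by (simp add: theta_plus_tau[OF assms] expi_half)
  finally have "theta \<tau> ?w = inverse (expi (1 / 2 + (- \<tau> / 2 - ?w))) * theta \<tau> (z + of_int m * \<tau>)"
    unfolding expi_add[symmetric] by (simp add: field_simps)
  also have "\<dots> = (expi (- (1 / 2 + (- \<tau> / 2 - ?w))) *
      expi (of_int m / 2 - of_int m ^ 2 * \<tau> / 2 - of_int m * z)) * theta \<tau> z"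
    unfolding step2 expi_minus by (simp only: mult.assoc)
  also have "expi (- (1 / 2 + (- \<tau> / 2 - ?w))) *
      expi (of_int m / 2 - of_int m ^ 2 * \<tau> / 2 - of_int m * z) =
      expi (of_int (m - 1) / 2 - of_int (m - 1) ^ 2 * \<tau> / 2 - of_int (m - 1) * z)"
    unfolding expi_add[symmetric] by (rule arg_cong[of _ _ expi]) (simp add: field_simps power2_eq_square)
  finally show ?case .
qed

lemma theta_plus_int: "theta \<tau> (z + of_int n) = expi (of_int n / 2) * theta \<tau> z"
proof (induction n rule: int_induct[where k = 0])
  case base
  show ?case by simp
next
  case (step1 n)
  have "theta \<tau> (z + of_int (n + 1)) = theta \<tau> ((z + of_int n) + 1)"
    by (simp add: algebra_simps)
  also have "\<dots> = (expi (1 / 2) * expi (of_int n / 2)) * theta \<tau> z"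
    by (simp only: theta_plus_1 step1 expi_half) simp
  also have "expi (1 / 2) * expi (of_int n / 2) = expi (of_int (n + 1) / 2)"
    unfolding expi_add[symmetric] by (simp add: field_simps)
  finally show ?case .
next
  case (step2 n)
  have "theta \<tau> (z + of_int n) = theta \<tau> ((z + of_int (n - 1)) + 1)"
    by (simp add: algebra_simps)
  hence "theta \<tau> (z + of_int (n - 1)) = - (expi (of_int n / 2) * theta \<tau> z)"
    by (simp only: theta_plus_1 step2) simp
  also have "\<dots> = (expi (of_int n / 2) / expi (1 / 2)) * theta \<tau> z"
    by (simp add: expi_half)
  also have "expi (of_int n / 2) / expi (1 / 2) = expi (of_int (n - 1) / 2)"
    unfolding expi_diff[symmetric] by (simp add: field_simps)
  finally show ?case .
qed

text \<open>
  The general quasi-periodicity. The sign \<open>(-1)\<^bsup>m+n\<^esup>\<close> is kept inside the exponential, so that identities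
  between multipliers reduce to identities between exponents up to integers.
\<close>

lemma theta_shift:
  assumes "Im \<tau> > 0"
  shows "theta \<tau> (z + of_int m * \<tau> + of_int n) =
           expi (of_int (m + n) / 2 - of_int m ^ 2 * \<tau> / 2 - of_int m * z) * theta \<tau> z"
proof -
  have "theta \<tau> (z + of_int m * \<tau> + of_int n) =
    (expi (of_int n / 2) * expi (of_int m / 2 - of_int m ^ 2 * \<tau> / 2 - of_int m * z)) * theta \<tau> z"
    by (simp add: theta_plus_int theta_plus_int_tau[OF assms])
  also have "expi (of_int n / 2) * expi (of_int m / 2 - of_int m ^ 2 * \<tau> / 2 - of_int m * z) =
    expi (of_int (m + n) / 2 - of_int m ^ 2 * \<tau> / 2 - of_int m * z)"
    unfolding expi_add[symmetric] by (rule arg_cong[of _ _ expi]) (simp add: field_simps)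
  finally show ?thesis .
qed

lemma theta_eq_0_iff:
  assumes "Im \<tau> > 0"
  shows "theta \<tau> z = 0 \<longleftrightarrow> (\<exists>m n :: int. z = of_int m * \<tau> + of_int n)"
proof
  assume "theta \<tau> z = 0"
  hence "(\<exists>k. expi z * expi \<tau> ^ k = 1) \<or> (\<exists>k. expi (\<tau> - z) * expi \<tau> ^ k = 1)"
    using assms by (auto simp: theta_def qpoch_eq_0_iff)
  hence "(\<exists>k::nat. expi (z + of_nat k * \<tau>) = 1) \<or> (\<exists>k::nat. expi (\<tau> - z + of_nat k * \<tau>) = 1)"
    unfolding expi_add expi_of_nat_mult .
  then consider k :: nat and n :: int where "z + of_nat k * \<tau> = of_int n"
    | k :: nat and n :: int where "\<tau> - z + of_nat k * \<tau> = of_int n"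
    unfolding expi_eq_1_iff by blast
  thus "\<exists>m n :: int. z = of_int m * \<tau> + of_int n"
  proof cases
    case 1
    thus ?thesis by (intro exI[of _ "- int k"] exI[of _ n]) (simp add: algebra_simps)
  next
    case 2
    thus ?thesis by (intro exI[of _ "int k + 1"] exI[of _ "- n"]) (simp add: algebra_simps)
  qed
next
  assume "\<exists>m n :: int. z = of_int m * \<tau> + of_int n"
  then obtain m n :: int where z: "z = of_int m * \<tau> + of_int n" by blast
  have "theta \<tau> 0 = 0"
    using assms by (simp add: theta_def qpoch_eq_0_iff exI[of _ "0::nat"])
  thus "theta \<tau> z = 0"
    using theta_shift[OF assms, of 0 m n] by (simp add: z)
qed

lemma theta_holomorphic:
  assumes "Im \<tau> > 0"
  shows "theta \<tau> holomorphic_on UNIV"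
proof -
  have q: "norm (expi \<tau>) < 1" using assms by simp
  have *: "(\<lambda>z. qpoch (expi \<tau>) (f z)) holomorphic_on UNIV" if "f holomorphic_on UNIV" for f
    using holomorphic_on_compose_gen[OF that qpoch_holomorphic_arg[OF q]] by (simp add: o_def)
  show ?thesis
    unfolding theta_def[abs_def] by (intro holomorphic_intros *) auto
qed

text \<open>
  Near 0, \<open>theta \<tau> z\<close> is \<open>1 - expi z\<close> times a function that does not vanish at 0.
\<close>

lemma theta_simple_zero:
  assumes "Im \<tau> > 0"
  shows "\<exists>d. d \<noteq> 0 \<and> (theta \<tau> has_field_derivative d) (at 0)"
proof -
  define q where "q = expi \<tau>"
  have q: "norm q < 1" using assms by (simp add: q_def)
  define W where "W = (\<lambda>z. expi (- z / 2) * (qpoch q (expi z * q) * qpoch q (expi (\<tau> - z))))"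
  have *: "(\<lambda>z. qpoch q (f z)) holomorphic_on UNIV" if "f holomorphic_on UNIV" for f
    using holomorphic_on_compose_gen[OF that qpoch_holomorphic_arg[OF q]] by (simp add: o_def)
  have "W holomorphic_on UNIV"
    unfolding W_def by (intro holomorphic_intros *) auto
  hence W: "(W has_field_derivative deriv W 0) (at 0)"
    by (auto intro: holomorphic_derivI)
  have "qpoch q q \<noteq> 0"
  proof -
    have "q * q ^ n \<noteq> 1" for n
    proof -
      have "norm (q ^ Suc n) \<le> norm q"
        using q by (simp only: norm_power) (intro power_Suc_le_self, auto)
      hence "norm (q ^ Suc n) < 1" using q by linarith
      thus ?thesis by auto
    qed
    thus ?thesis using qpoch_eq_0_iff[OF q] by auto
  qed
  hence W0: "W 0 \<noteq> 0" by (simp add: W_def q_def)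
  have th: "theta \<tau> = (\<lambda>z. (1 - expi z) * W z)"
  proof
    fix z
    have "qpoch q (expi z) = (1 - expi z) * qpoch q (expi z * q)" by (rule qpoch_rec[OF q])
    thus "theta \<tau> z = (1 - expi z) * W z"
      unfolding theta_def W_def q_def[symmetric] by (simp only: mult_ac)
  qed
  have "((\<lambda>z. 1 - expi z) has_field_derivative (- (2 * of_real pi * \<i>))) (at 0)"
    unfolding expi_def by (auto intro!: derivative_eq_intros)
  from DERIV_mult'[OF this W] have "(theta \<tau> has_field_derivative (- (2 * of_real pi * \<i>)) * W 0) (at 0)"
    by (simp add: th)
  thus ?thesis using W0 by (intro exI[of _ "- (2 * of_real pi * \<i>) * W 0"]) auto
qed

section \<open>Modular transformation of the theta function\<close>

text \<open>
  The quotient of \<open>g\<close> and \<open>theta \<tau>\<close> is invariant under the lattice. Its singularity at 0 is removable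
  because \<open>theta \<tau>\<close> has a simple zero there and \<open>g\<close> vanishes, and by periodicity the same holds at every
  lattice point. An entire function that takes all its values on a compact period parallelogram is bounded, so
  Liouville's theorem applies.
\<close>

lemma theta_unique:
  assumes \<tau>: "Im \<tau> > 0" and g: "g holomorphic_on UNIV"
    and g1: "\<And>z. g (z + 1) = - g z"
    and g\<tau>: "\<And>z. g (z + \<tau>) = - expi (- \<tau> / 2 - z) * g z"
    and g0: "\<And>m n :: int. g (of_int m * \<tau> + of_int n) = 0"
  shows "\<exists>C. \<forall>z. g z = C * theta \<tau> z"
proof -
  let ?th = "theta \<tau>"
  obtain d where d: "d \<noteq> 0" "(?th has_field_derivative d) (at 0)"
    using theta_simple_zero[OF \<tau>] by blast
  define e where "e = deriv g 0"
  have e: "(g has_field_derivative e) (at 0)"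
    using g unfolding e_def by (auto intro: holomorphic_derivI)
  have th0: "?th 0 = 0" using theta_eq_0_iff[OF \<tau>, of 0] by (auto intro!: exI[of _ "0::int"])
  have lim_th: "((\<lambda>z. ?th z / z) \<longlongrightarrow> d) (at 0)" using d th0 by (simp add: has_field_derivative_iff)
  have lim_g: "((\<lambda>z. g z / z) \<longlongrightarrow> e) (at 0)"
    using e g0[of 0 0] by (simp add: has_field_derivative_iff)
  \<comment> \<open>The value \<open>e / d\<close> is the limit of \<open>g / ?th\<close> at 0, and by periodicity at every lattice point.\<close>
  define F where "F = (\<lambda>z. if ?th z = 0 then e / d else g z / ?th z)"
  have ev: "eventually (\<lambda>z. ?th z \<noteq> 0) (at 0)"
    using tendsto_imp_eventually_ne[OF lim_th d(1)] by eventually_elim auto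
  have F0: "(F \<longlongrightarrow> F 0) (at 0)"
  proof -
    have "((\<lambda>z. (g z / z) / (?th z / z)) \<longlongrightarrow> e / d) (at 0)"
      by (intro tendsto_divide lim_g lim_th d)
    moreover have "eventually (\<lambda>z. (g z / z) / (?th z / z) = F z) (at 0)"
      using ev eventually_neq_at_within[of 0 0 UNIV] by eventually_elim (simp add: F_def)
    ultimately show ?thesis using th0 by (simp add: F_def Lim_transform_eventually)
  qed
  have Fhol: "F holomorphic_on {z. ?th z \<noteq> 0}"
  proof (subst holomorphic_cong[OF refl])
    show "F z = g z / ?th z" if "z \<in> {z. ?th z \<noteq> 0}" for z using that by (simp add: F_def)
    show "(\<lambda>z. g z / ?th z) holomorphic_on {z. ?th z \<noteq> 0}"
      using holomorphic_on_subset[OF g] holomorphic_on_subset[OF theta_holomorphic[OF \<tau>]]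
      by (intro holomorphic_intros) auto
  qed
  have opn: "open {z. ?th z \<noteq> 0}"
    by (intro open_Collect_neq holomorphic_on_imp_continuous_on theta_holomorphic \<tau> continuous_intros)
  have Fd0: "F field_differentiable at 0"
  proof -
    from ev obtain r where r: "r > 0" "\<And>z. z \<in> ball 0 r - {0} \<Longrightarrow> ?th z \<noteq> 0"
      unfolding eventually_at by (auto simp: dist_commute)
    have "F holomorphic_on ball 0 r"
      by (rule no_isolated_singularity'[where K = "{0}"])
         (use F0 r in \<open>auto intro: holomorphic_on_subset[OF Fhol] tendsto_within_subset\<close>)
    thus ?thesis using r by (auto intro: holomorphic_on_imp_differentiable_at)
  qed
  interpret F1: periodic_fun_simple F 1
    by standard (simp add: F_def theta_plus_1 g1)
  interpret F\<tau>: periodic_fun_simple F \<tau>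
    by standard (simp add: F_def theta_plus_tau[OF \<tau>] g\<tau>)
  have per: "F (z - (of_int m * \<tau> + of_int n)) = F z" for z and m n :: int
    using F\<tau>.minus_of_int[of z m] F1.minus_of_int[of "z - of_int m * \<tau>" n] by (simp add: algebra_simps)
  have "F field_differentiable at z" for z
  proof (cases "?th z = 0")
    case False
    thus ?thesis using Fhol opn by (auto intro: holomorphic_on_imp_differentiable_at)
  next
    case True
    then obtain m n :: int where z: "z = of_int m * \<tau> + of_int n"
      using theta_eq_0_iff[OF \<tau>] by blast
    have "(F \<circ> (\<lambda>w. w - z)) field_differentiable at z"
      by (rule field_differentiable_compose) (use Fd0 in \<open>auto intro!: derivative_intros\<close>)
    also have "F \<circ> (\<lambda>w. w - z) = F" using per[of _ m n] by (auto simp: z o_def)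
    finally show ?thesis .
  qed
  hence ent: "F holomorphic_on UNIV"
    by (simp add: holomorphic_on_def field_differentiable_at_within)
  \<comment> \<open>The closed period parallelogram; fractional parts of the coordinates move every point into it.\<close>
  define K where "K = (\<lambda>(s, t). of_real s * \<tau> + of_real t) ` ({0..1} \<times> {0..1::real})"
  have "compact K" unfolding K_def
    by (intro compact_continuous_image compact_Times) (auto intro!: continuous_intros simp: case_prod_unfold)
  hence "compact (F ` K)"
    using holomorphic_on_imp_continuous_on[OF ent] by (intro compact_continuous_image) (auto intro: continuous_on_subset)
  moreover have "range F \<subseteq> F ` K"
  proof safe
    fix z
    define s where "s = Im z / Im \<tau>"
    define t where "t = Re z - s * Re \<tau>"
    have z: "z = of_real s * \<tau> + of_real t"
      using \<tau> by (simp add: complex_eq_iff s_def t_def)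
    have "F z = F (of_real (frac s) * \<tau> + of_real (frac t))"
      using per[of z "\<lfloor>s\<rfloor>" "\<lfloor>t\<rfloor>"] by (simp add: z frac_def algebra_simps)
    moreover have "of_real (frac s) * \<tau> + of_real (frac t) \<in> K"
      unfolding K_def by (rule image_eqI[of _ _ "(frac s, frac t)"]) (auto simp: frac_lt_1 less_imp_le)
    ultimately show "F z \<in> F ` K" by simp
  qed
  ultimately have "bounded (range F)"
    using compact_imp_bounded bounded_subset by blast
  then obtain C where C: "\<And>z. F z = C"
    using Liouville_theorem[OF ent] by (auto simp: constant_on_def)
  have "g z = C * ?th z" for z
  proof (cases "?th z = 0")
    case True
    then obtain m n :: int where "z = of_int m * \<tau> + of_int n"
      using theta_eq_0_iff[OF \<tau>] by blast
    thus ?thesis using True g0 by simp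
  next
    case False
    thus ?thesis using C[of z] by (simp add: F_def field_simps)
  qed
  thus ?thesis by blast
qed

lemma Im_moebius_pos:
  fixes a b c d :: int
  assumes "a * d - b * c = 1" "Im \<tau> > 0"
  shows "of_int c * \<tau> + of_int d \<noteq> 0"
    and "Im ((of_int a * \<tau> + of_int b) / (of_int c * \<tau> + of_int d)) > 0"
proof -
  let ?J = "of_int c * \<tau> + of_int d"
  show J: "?J \<noteq> 0"
  proof
    assume "?J = 0"
    hence "Im ?J = 0" "Re ?J = 0" by simp_all
    with assms(2) have "c = 0" "d = 0" by auto
    with assms(1) show False by simp
  qed
  have det: "real_of_int a * of_int d - of_int b * of_int c = 1"
    using assms(1) by (metis of_int_1 of_int_diff of_int_mult)
  have "Im ((of_int a * \<tau> + of_int b) / ?J) =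
      ((of_int a * of_int d - of_int b * of_int c) * Im \<tau>) / (cmod ?J)\<^sup>2"
    by (simp add: Im_divide cmod_power2 algebra_simps)
  also have "\<dots> > 0" using J assms(2) by (simp only: det) simp
  finally show "Im ((of_int a * \<tau> + of_int b) / ?J) > 0" .
qed

text \<open>
  Let \<open>T\<close> be the transformed period. The identities \<open>1 / J = a - c T\<close> and \<open>\<tau> / J = d T - b\<close> show that
  division by \<open>J\<close> maps the lattice of \<open>\<tau>\<close> to that of \<open>T\<close>. The Gaussian factor in \<open>g\<close> corrects the
  exponents, so that \<open>g\<close> and \<open>theta \<tau>\<close> have the same multipliers for the two basic periods.
\<close>

lemma theta_modular:
  fixes a b c d :: int
  assumes det: "a * d - b * c = 1" and \<tau>: "Im \<tau> > 0"
  defines "J \<equiv> of_int c * \<tau> + of_int d"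
  shows "\<exists>C. C \<noteq> 0 \<and> (\<forall>z. theta ((of_int a * \<tau> + of_int b) / J) (z / J) =
           C * expi (of_int c * z\<^sup>2 / (2 * J)) * theta \<tau> z)"
proof -
  define T where "T = (of_int a * \<tau> + of_int b) / J"
  have J: "J \<noteq> 0" and T: "Im T > 0" using Im_moebius_pos[OF det \<tau>] by (simp_all add: T_def J_def)
  have detc: "of_int a * of_int d - of_int b * of_int c = (1 :: complex)"
    using det by (metis of_int_1 of_int_diff of_int_mult)
  have TJ: "T * J = of_int a * \<tau> + of_int b" using J by (simp add: T_def)
  have invJ: "1 / J = of_int a - of_int c * T"
  proof -
    have "(of_int a - of_int c * T) * J = of_int a * J - of_int c * (T * J)" by (simp add: algebra_simps)
    also have "\<dots> = 1" unfolding TJ using detc by (simp add: J_def algebra_simps)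
    finally show ?thesis using J by (simp add: field_simps)
  qed
  have tauJ: "\<tau> / J = of_int d * T - of_int b"
  proof -
    have "(of_int d * T - of_int b) * J = of_int d * (T * J) - of_int b * J" by (simp add: algebra_simps)
    also have "\<dots> = (of_int a * of_int d - of_int b * of_int c) * \<tau>" unfolding TJ by (simp add: J_def algebra_simps)
    finally show ?thesis using J detc by (simp add: field_simps)
  qed
  define g where "g = (\<lambda>z. expi (- (of_int c * z\<^sup>2 / (2 * J))) * theta T (z / J))"
  \<comment> \<open>The multipliers acquire the signs \<open>(-1)\<close> to these powers. They are odd because \<open>a - c - a * c\<close> is even only if \<open>a\<close> and \<open>c\<close> both are, which the determinant excludes; likewise for \<open>b\<close> and \<open>d\<close>.\<close>
  have odds: "odd (a - c - a * c)" "odd (d - b - b * d)"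
    using arg_cong[OF det, of even] by auto
  have "\<exists>C. \<forall>z. g z = C * theta \<tau> z"
  proof (rule theta_unique[OF \<tau>])
    have *: "(\<lambda>z. theta T (f z)) holomorphic_on UNIV" if "f holomorphic_on UNIV" for f
      using holomorphic_on_compose_gen[OF that theta_holomorphic[OF T]] by (simp add: o_def)
    show "g holomorphic_on UNIV"
      unfolding g_def using J by (intro holomorphic_intros *) auto
  next
    fix z
    have arg: "(z + 1) / J = z / J + of_int (- c) * T + of_int a"
      using invJ by (simp add: add_divide_distrib)
    have "g (z + 1) = (expi (- (of_int c * (z + 1)\<^sup>2 / (2 * J))) *
        expi (of_int (- c + a) / 2 - of_int (- c) ^ 2 * T / 2 - of_int (- c) * (z / J))) * theta T (z / J)"
      unfolding g_def arg theta_shift[OF T] by (simp only: mult.assoc)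
    also have "expi (- (of_int c * (z + 1)\<^sup>2 / (2 * J))) *
        expi (of_int (- c + a) / 2 - of_int (- c) ^ 2 * T / 2 - of_int (- c) * (z / J)) =
        expi (of_int (a - c - a * c) / 2 + (- (of_int c * z\<^sup>2 / (2 * J))))"
    proof -
      have "- (of_int c * (z + 1)\<^sup>2 / (2 * J)) +
        (of_int (- c + a) / 2 - of_int (- c) ^ 2 * T / 2 - of_int (- c) * (z / J)) =
        - (of_int c * (z + 1)\<^sup>2 * (1 / J) / 2) +
        (of_int (- c + a) / 2 - of_int (- c) ^ 2 * T / 2 - of_int (- c) * (z * (1 / J)))" by simp
      also have "\<dots> = of_int (a - c - a * c) / 2 + (- (of_int c * z\<^sup>2 * (1 / J) / 2))"
        unfolding invJ by (simp add: field_simps power2_eq_square)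
      also have "of_int c * z\<^sup>2 * (1 / J) / 2 = of_int c * z\<^sup>2 / (2 * J)" by simp
      finally show ?thesis unfolding expi_add[symmetric] by (rule arg_cong)
    qed
    finally show "g (z + 1) = - g z"
      unfolding expi_add expi_odd_half[OF odds(1)] by (simp add: g_def)
  next
    fix z
    have arg: "(z + \<tau>) / J = z / J + of_int d * T + of_int (- b)"
      using tauJ by (simp add: add_divide_distrib)
    have "g (z + \<tau>) = (expi (- (of_int c * (z + \<tau>)\<^sup>2 / (2 * J))) *
        expi (of_int (d + - b) / 2 - of_int d ^ 2 * T / 2 - of_int d * (z / J))) * theta T (z / J)"
      unfolding g_def arg theta_shift[OF T] by (simp only: mult.assoc)
    also have "expi (- (of_int c * (z + \<tau>)\<^sup>2 / (2 * J))) *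
        expi (of_int (d + - b) / 2 - of_int d ^ 2 * T / 2 - of_int d * (z / J)) =
        expi (of_int (d - b - b * d) / 2 + ((- \<tau> / 2 - z) + (- (of_int c * z\<^sup>2 / (2 * J)))))"
    proof -
      have z: "of_int d * (z / J) = z - of_int c * z * (\<tau> / J)"
        using J by (simp add: field_simps) (simp add: J_def algebra_simps)
      have T2: "of_int d ^ 2 * T + of_int c * \<tau> * (\<tau> / J) = \<tau> + of_int b * of_int d"
      proof -
        have "of_int d ^ 2 * T + of_int c * \<tau> * (\<tau> / J) = of_int d * (T * J) - of_int b * of_int c * \<tau>"
          unfolding tauJ by (simp add: J_def algebra_simps power2_eq_square)
        also have "\<dots> = (of_int a * of_int d - of_int b * of_int c) * \<tau> + of_int b * of_int d"
          unfolding TJ by (simp add: algebra_simps)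
        finally show ?thesis by (simp add: detc)
      qed
      have "- (of_int c * (z + \<tau>)\<^sup>2 / (2 * J)) +
        (of_int (d + - b) / 2 - of_int d ^ 2 * T / 2 - of_int d * (z / J)) =
         - (of_int c * z\<^sup>2 / (2 * J)) - of_int c * z * (\<tau> / J) - of_int d * (z / J)
         + of_int (d - b) / 2 - (of_int d ^ 2 * T + of_int c * \<tau> * (\<tau> / J)) / 2"
        using J by (simp add: field_simps power2_eq_square)
      also have "\<dots> = of_int (d - b - b * d) / 2 + ((- \<tau> / 2 - z) + (- (of_int c * z\<^sup>2 / (2 * J))))"
        unfolding T2 z by (simp add: field_simps)
      finally show ?thesis unfolding expi_add[symmetric] by (rule arg_cong)
    qed
    finally show "g (z + \<tau>) = - expi (- \<tau> / 2 - z) * g z"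
      unfolding expi_add expi_odd_half[OF odds(2)] by (simp add: g_def)
  next
    fix m n :: int
    have "(of_int m * \<tau> + of_int n) / J = of_int m * (\<tau> / J) + of_int n * (1 / J)"
      by (simp add: add_divide_distrib)
    also have "\<dots> = of_int (m * d - n * c) * T + of_int (n * a - m * b)"
      unfolding tauJ invJ by (simp add: algebra_simps)
    finally have "theta T ((of_int m * \<tau> + of_int n) / J) = 0"
      using theta_eq_0_iff[OF T] by blast
    thus "g (of_int m * \<tau> + of_int n) = 0" by (simp add: g_def)
  qed
  then obtain C where C: "\<And>z. g z = C * theta \<tau> z" by blast
  have trans: "theta T (z / J) = C * expi (of_int c * z\<^sup>2 / (2 * J)) * theta \<tau> z" for z
    using C[of z] by (simp add: g_def expi_minus field_simps)
  have "C \<noteq> 0"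
  proof
    assume "C = 0"
    hence zero: "theta T w = 0" for w using trans[of "w * J"] J by simp
    from zero have "theta T = (\<lambda>_. 0)" by auto
    moreover obtain d where "d \<noteq> 0" "(theta T has_field_derivative d) (at 0)"
      using theta_simple_zero[OF T] by blast
    ultimately show False by (metis DERIV_const DERIV_unique)
  qed
  with trans show ?thesis unfolding T_def by blast
qed

section \<open>The elliptic genus as a quotient of theta functions\<close>

lemma elliptic_genus_C2_eq_qpoch:
  fixes \<tau> z x :: complex
  assumes "Im \<tau> > 0"
  defines "q \<equiv> expi \<tau>" and "y \<equiv> expi z" and "t \<equiv> expi x"
  shows "elliptic_genus_C2 \<tau> z x = inverse y *
    ((qpoch q (y * t) * qpoch q (inverse y * q * inverse t) * qpoch q (y * inverse t) * qpoch q (inverse y * q * t)) /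
     (qpoch q t * qpoch q (q * inverse t) * qpoch q (inverse t) * qpoch q (q * t)))"
proof -
  have q: "norm q < 1" using assms by simp
  have P: "(\<lambda>n. 1 - u * q ^ n) has_prod qpoch q u" for u by (rule has_prod_qpoch[OF q])
  have P1: "(\<lambda>n. 1 - u * q ^ n * v) has_prod qpoch q (u * v)" for u v
    using P[of "u * v"] by (simp add: mult_ac)
  have P2: "(\<lambda>n. 1 - u * q ^ Suc n * v) has_prod qpoch q (u * q * v)" for u v
    using P[of "u * q * v"] by (simp add: mult_ac)
  have P3: "(\<lambda>n. 1 - q ^ n * v) has_prod qpoch q v" "(\<lambda>n. 1 - q ^ Suc n * v) has_prod qpoch q (q * v)" for v
    using P1[of 1 v] P2[of 1 v] by simp_all
  have H: "(\<lambda>n. ((1 - y * q ^ n * t) * (1 - inverse y * q ^ Suc n * inverse t)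
             * (1 - y * q ^ n * inverse t) * (1 - inverse y * q ^ Suc n * t))
         / ((1 - q ^ n * t) * (1 - q ^ Suc n * inverse t)
             * (1 - q ^ n * inverse t) * (1 - q ^ Suc n * t))) has_prod
    ((qpoch q (y * t) * qpoch q (inverse y * q * inverse t) * qpoch q (y * inverse t) * qpoch q (inverse y * q * t)) /
     (qpoch q t * qpoch q (q * inverse t) * qpoch q (inverse t) * qpoch q (q * t)))"
    by (intro has_prod_divide has_prod_mult P1 P2 P3)
  show ?thesis
    unfolding elliptic_genus_C2_def Let_def expi_def[symmetric]
    unfolding q_def[symmetric] y_def[symmetric] t_def[symmetric]
    by (subst has_prod_unique[OF H, symmetric]) (rule refl)
qed

text \<open>
  The identity also holds at the poles: there both sides are 0 by the convention on division by zero. The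
  exponential prefactors of the theta functions combine to \<open>y\<^sup>-\<^sup>1\<close>.
\<close>

lemma elliptic_genus_C2_eq_theta:
  assumes "Im \<tau> > 0"
  shows "elliptic_genus_C2 \<tau> z x =
           theta \<tau> (z + x) * theta \<tau> (z - x) / (theta \<tau> x * theta \<tau> (- x))"
proof -
  define q y t where "q = expi \<tau>" and "y = expi z" and "t = expi x"
  note elliptic_genus_C2_eq_qpoch[OF assms, of z x, folded q_def y_def t_def]
  moreover have "theta \<tau> (z + x) = expi (- (z + x) / 2) * (qpoch q (y * t) * qpoch q (inverse y * q * inverse t))"
    by (simp add: theta_def q_def y_def t_def expi_add expi_diff field_simps)
  moreover have "theta \<tau> (z - x) = expi (- (z - x) / 2) * (qpoch q (y * inverse t) * qpoch q (inverse y * q * t))"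
    by (simp add: theta_def q_def y_def t_def expi_add expi_diff field_simps)
  moreover have "theta \<tau> x = expi (- x / 2) * (qpoch q t * qpoch q (q * inverse t))"
    by (simp add: theta_def q_def t_def expi_add expi_diff field_simps)
  moreover have "theta \<tau> (- x) = expi (x / 2) * (qpoch q (inverse t) * qpoch q (q * t))"
    by (simp add: theta_def q_def t_def expi_add expi_diff expi_minus field_simps)
  moreover have "expi (- (z + x) / 2) * expi (- (z - x) / 2) = inverse y * (expi (- x / 2) * expi (x / 2))"
    unfolding y_def expi_minus[symmetric] expi_add[symmetric]
    by (rule arg_cong[of _ _ expi]) (simp add: field_simps)
  moreover have "expi (- x / 2) * expi (x / 2) = 1"
    unfolding expi_add[symmetric] by simp
  ultimately show ?thesis
    by (simp add: field_simps)
qed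

abbreviation genus_index :: "rat ^ 2 ^ 2" where
  "genus_index \<equiv> vector [vector [1, 0], vector [0, 0]]"

lemma index_form_genus_index: "index_form genus_index w w' = w $ 1 * w' $ 1"
  by (simp add: index_form_def sum_2)

lemma jacobi_index_genus_index: "jacobi_index genus_index"
  unfolding jacobi_index_def
proof (intro conjI allI)
  show "transpose genus_index = genus_index" by (simp add: vec_eq_iff transpose_def forall_2)
  have "\<forall>i j. 2 * genus_index $ i $ j \<in> \<int>" by (simp add: forall_2)
  thus "2 * genus_index $ i $ j \<in> \<int>" for i j by blast
  have "\<forall>i. \<exists>m::int. even m \<and> 2 * genus_index $ i $ i = of_int m"
    unfolding forall_2 by (auto intro: exI[of _ "2::int"] exI[of _ "0::int"])
  thus "\<exists>m::int. even m \<and> 2 * genus_index $ i $ i = of_int m" for i by blast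
qed

text \<open>
  The constant of \<open>theta_modular\<close> occurs to the second power in the numerator and in the denominator, and
  \<open>(z + x)\<^sup>2 + (z - x)\<^sup>2 - 2 x\<^sup>2 = 2 z\<^sup>2\<close>.
\<close>

lemma elliptic_genus_C2_modular:
  fixes a b c d :: int
  assumes det: "a * d - b * c = 1" and \<tau>: "Im \<tau> > 0"
  defines "J \<equiv> of_int c * \<tau> + of_int d"
  shows "elliptic_genus_C2 ((of_int a * \<tau> + of_int b) / J) (z / J) (x / J) =
           expi (of_int c * z\<^sup>2 / J) * elliptic_genus_C2 \<tau> z x"
proof -
  define T where "T = (of_int a * \<tau> + of_int b) / J"
  have T: "Im T > 0" using Im_moebius_pos[OF det \<tau>] by (simp add: T_def J_def)
  obtain C where C: "C \<noteq> 0" "\<And>z. theta T (z / J) = C * expi (of_int c * z\<^sup>2 / (2 * J)) * theta \<tau> z"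
    using theta_modular[OF det \<tau>] unfolding T_def J_def by blast
  let ?e = "\<lambda>z. expi (of_int c * z\<^sup>2 / (2 * J))"
  have e: "?e (z + x) * ?e (z - x) = expi (of_int c * z\<^sup>2 / J) * (?e x * ?e (- x))"
    unfolding expi_add[symmetric]
    by (rule arg_cong[of _ _ expi])
       (simp add: add_divide_distrib[symmetric], simp add: power2_eq_square algebra_simps add_divide_distrib diff_divide_distrib)
  have "elliptic_genus_C2 T (z / J) (x / J) =
     theta T ((z + x) / J) * theta T ((z - x) / J) / (theta T (x / J) * theta T (- x / J))"
    by (simp add: elliptic_genus_C2_eq_theta[OF T] add_divide_distrib diff_divide_distrib)
  also have "\<dots> = ((C * C) * (?e (z + x) * ?e (z - x)) * (theta \<tau> (z + x) * theta \<tau> (z - x))) /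
      ((C * C) * (?e x * ?e (- x)) * (theta \<tau> x * theta \<tau> (- x)))"
    unfolding C(2) by (simp add: mult_ac)
  also have "\<dots> = ((?e (z + x) * ?e (z - x)) / (?e x * ?e (- x))) *
      (theta \<tau> (z + x) * theta \<tau> (z - x) / (theta \<tau> x * theta \<tau> (- x)))"
    by (simp only: mult.assoc times_divide_times_eq mult_divide_mult_cancel_left[OF C(1)])
  also have "(?e (z + x) * ?e (z - x)) / (?e x * ?e (- x)) = expi (of_int c * z\<^sup>2 / J)"
    unfolding e by simp
  finally show ?thesis by (simp add: elliptic_genus_C2_eq_theta[OF \<tau>] T_def)
qed

text \<open>
  The exponents of the four theta factors add up to the claimed one plus the integer \<open>k + m\<close>, on which
  \<open>expi\<close> is 1.
\<close>

lemma elliptic_genus_C2_elliptic: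
  fixes k l m n :: int
  assumes \<tau>: "Im \<tau> > 0"
  shows "elliptic_genus_C2 \<tau> (z + \<tau> * of_int k + of_int m) (x + \<tau> * of_int l + of_int n) =
           expi (- (\<tau> * of_int k ^ 2) - 2 * z * of_int k) * elliptic_genus_C2 \<tau> z x"
proof -
  let ?E = "\<lambda>m n z. expi (of_int (m + n) / 2 - of_int m ^ 2 * \<tau> / 2 - of_int m * z)"
  let ?z = "z + \<tau> * of_int k + of_int m" and ?x = "x + \<tau> * of_int l + of_int n"
  have args: "?z + ?x = (z + x) + of_int (k + l) * \<tau> + of_int (m + n)"
    "?z - ?x = (z - x) + of_int (k - l) * \<tau> + of_int (m - n)"
    "?x = x + of_int l * \<tau> + of_int n" "- ?x = (- x) + of_int (- l) * \<tau> + of_int (- n)"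
    by (simp_all add: algebra_simps)
  have e: "?E (k + l) (m + n) (z + x) * ?E (k - l) (m - n) (z - x) =
     expi (- (\<tau> * of_int k ^ 2) - 2 * z * of_int k) * (?E l n x * ?E (- l) (- n) (- x))"
  proof -
    have "?E (k + l) (m + n) (z + x) * ?E (k - l) (m - n) (z - x) =
      expi (of_int (k + m) + ((- (\<tau> * of_int k ^ 2) - 2 * z * of_int k) +
         ((of_int (l + n) / 2 - of_int l ^ 2 * \<tau> / 2 - of_int l * x) +
          (of_int (- l + - n) / 2 - of_int (- l) ^ 2 * \<tau> / 2 - of_int (- l) * (- x)))))"
      unfolding expi_add[symmetric]
      by (rule arg_cong[of _ _ expi]) (simp add: field_simps power2_eq_square)
    thus ?thesis unfolding expi_add[of "of_int (k + m)"] expi_of_int by (simp only: expi_add mult_1)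
  qed
  have "elliptic_genus_C2 \<tau> ?z ?x =
     ((?E (k + l) (m + n) (z + x) * ?E (k - l) (m - n) (z - x)) * (theta \<tau> (z + x) * theta \<tau> (z - x))) /
     ((?E l n x * ?E (- l) (- n) (- x)) * (theta \<tau> x * theta \<tau> (- x)))"
    unfolding elliptic_genus_C2_eq_theta[OF \<tau>] args(1,2,4) unfolding args(3) theta_shift[OF \<tau>]
    by (simp only: mult_ac)
  also have "\<dots> = ((?E (k + l) (m + n) (z + x) * ?E (k - l) (m - n) (z - x)) / (?E l n x * ?E (- l) (- n) (- x))) *
     elliptic_genus_C2 \<tau> z x"
    unfolding elliptic_genus_C2_eq_theta[OF \<tau>] by (simp only: times_divide_times_eq)
  also have "(?E (k + l) (m + n) (z + x) * ?E (k - l) (m - n) (z - x)) / (?E l n x * ?E (- l) (- n) (- x)) =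
     expi (- (\<tau> * of_int k ^ 2) - 2 * z * of_int k)"
    unfolding e by (simp del: of_int_add of_int_minus)
  finally show ?thesis .
qed

lemma modular_law_elliptic_genus:
  "modular_law 0 genus_index (\<lambda>(\<tau>, w). elliptic_genus_C2 \<tau> (w $ 1) (w $ 2))"
  unfolding modular_law_def Let_def
proof (intro allI impI)
  fix a b c d :: int and \<tau> and w :: "complex ^ 2"
  assume det: "a * d - b * c = 1" and \<tau>: "0 < Im \<tau>"
  show "(case ((of_int a * \<tau> + of_int b) / (of_int c * \<tau> + of_int d), (1 / (of_int c * \<tau> + of_int d)) *s w) of
          (\<tau>, w) \<Rightarrow> elliptic_genus_C2 \<tau> (w $ 1) (w $ 2)) =
        (of_int c * \<tau> + of_int d) powi 0 *
        exp (2 * of_real pi * \<i> * of_int c * index_quad genus_index w / (of_int c * \<tau> + of_int d)) *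
        (case (\<tau>, w) of (\<tau>, w) \<Rightarrow> elliptic_genus_C2 \<tau> (w $ 1) (w $ 2))"
    using elliptic_genus_C2_modular[OF det \<tau>, of "w $ 1" "w $ 2"]
    by (simp add: index_quad_def index_form_genus_index expi_def power2_eq_square mult.assoc)
qed

lemma elliptic_law_elliptic_genus:
  "elliptic_law genus_index (\<lambda>(\<tau>, w). elliptic_genus_C2 \<tau> (w $ 1) (w $ 2))"
  unfolding elliptic_law_def Let_def
proof (intro allI impI)
  fix \<alpha> \<mu> :: "int ^ 2" and \<tau> and w :: "complex ^ 2"
  assume \<tau>: "0 < Im \<tau>"
  have "expi (- (\<tau> * of_int (\<alpha> $ 1) ^ 2) - 2 * w $ 1 * of_int (\<alpha> $ 1)) =
     exp (- 2 * of_real pi * \<i> * \<tau> * index_quad genus_index (cvec_of_int \<alpha>)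
        - 4 * of_real pi * \<i> * index_form genus_index w (cvec_of_int \<alpha>))"
    unfolding expi_def
    by (rule arg_cong[of _ _ exp])
       (simp add: index_quad_def index_form_genus_index cvec_of_int_def power2_eq_square algebra_simps)
  with elliptic_genus_C2_elliptic[OF \<tau>, of "w $ 1" "\<alpha> $ 1" "\<mu> $ 1" "w $ 2" "\<alpha> $ 2" "\<mu> $ 2"]
  show "(case (\<tau>, w + \<tau> *s cvec_of_int \<alpha> + cvec_of_int \<mu>) of (\<tau>, w) \<Rightarrow> elliptic_genus_C2 \<tau> (w $ 1) (w $ 2)) =
     exp (- 2 * of_real pi * \<i> * \<tau> * index_quad genus_index (cvec_of_int \<alpha>)
        - 4 * of_real pi * \<i> * index_form genus_index w (cvec_of_int \<alpha>)) *
     (case (\<tau>, w) of (\<tau>, w) \<Rightarrow> elliptic_genus_C2 \<tau> (w $ 1) (w $ 2))"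
    by (simp add: cvec_of_int_def)
qed

section \<open>Meromorphy\<close>

text \<open>
  All arguments of the factors \<open>E\<close> are exponentials of linear forms in \<open>(\<tau>, z, x)\<close>.
\<close>

lemma holomorphic_several_on_expi_linear:
  assumes U: "open (U :: (complex \<times> (complex ^ 2)) set)"
  shows "holomorphic_several_on (\<lambda>p. expi (a * fst p + (b * snd p $ 1 + c * snd p $ 2))) U"
  unfolding holomorphic_several_on_def
proof (intro conjI ballI U)
  fix p :: "complex \<times> (complex ^ 2)"
  let ?l = "\<lambda>p :: complex \<times> (complex ^ 2). a * fst p + (b * snd p $ 1 + c * snd p $ 2)"
  have nth: "bounded_linear (\<lambda>p :: complex \<times> (complex ^ 2). snd p $ i)" for i
    by (rule bounded_linear_compose[OF bounded_linear_vec_nth bounded_linear_snd])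
  have "bounded_linear ?l"
    by (intro bounded_linear_add bounded_linear_mult_right[THEN bounded_linear_compose] nth bounded_linear_fst)
  hence l: "(?l has_derivative ?l) (at p)" by (rule bounded_linear_imp_has_derivative)
  have "(expi has_field_derivative (2 * of_real pi * \<i> * expi (?l p))) (at (?l p))"
    unfolding expi_def[abs_def] by (auto intro!: derivative_eq_intros)
  from has_derivative_compose[OF l this[unfolded has_field_derivative_def]]
  show "\<exists>D. ((\<lambda>p. expi (?l p)) has_derivative D) (at p) \<and> (\<forall>s \<sigma> v. D (s * \<sigma>, s *s v) = s * D (\<sigma>, v))"
    by (intro exI conjI) (auto simp: algebra_simps)
qed

lemma open_jacobi_domain: "open (jacobi_domain :: (complex \<times> (complex ^ 'r)) set)"
  unfolding jacobi_domain_def by (intro open_Times open_halfspace_Im_gt) auto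

lemma theta_holomorphic_several:
  "holomorphic_several_on (\<lambda>p. theta (fst p) (b * snd p $ 1 + c * snd p $ 2)) (jacobi_domain :: (complex \<times> (complex ^ 2)) set)"
proof -
  let ?U = "jacobi_domain :: (complex \<times> (complex ^ 2)) set"
  have E: "holomorphic_several_on (\<lambda>p. expi (a * fst p + (b * snd p $ 1 + c * snd p $ 2))) ?U" for a b c
    by (rule holomorphic_several_on_expi_linear[OF open_jacobi_domain])
  have Q: "holomorphic_several_on (\<lambda>p. qpoch (expi (fst p)) (g p)) ?U" if "holomorphic_several_on g ?U" for g
  proof (rule holomorphic_several_on_compose[where F = qpoch and A = "ball 0 1" and B = UNIV])
    show "continuous_on (ball 0 1 \<times> UNIV) (\<lambda>(x, y). qpoch x y)"
      using qpoch_continuous_on by (simp add: case_prod_unfold)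
    show "(\<lambda>x. qpoch x y) holomorphic_on ball 0 1" for y by (rule qpoch_holomorphic_base)
    show "qpoch x holomorphic_on UNIV" if "x \<in> ball 0 1" for x
      using that by (intro qpoch_holomorphic_arg) auto
    show "holomorphic_several_on (\<lambda>p. expi (fst p)) ?U" using E[of 1 0 0] by simp
  qed (use that in \<open>auto simp: jacobi_domain_def\<close>)
  have "holomorphic_several_on (\<lambda>p. expi (0 * fst p + ((- b / 2) * snd p $ 1 + (- c / 2) * snd p $ 2)) *
     (qpoch (expi (fst p)) (expi (0 * fst p + (b * snd p $ 1 + c * snd p $ 2))) *
      qpoch (expi (fst p)) (expi (1 * fst p + ((- b) * snd p $ 1 + (- c) * snd p $ 2))))) ?U"
    by (intro holomorphic_several_on_mult Q E)
  moreover have "theta (fst p) (b * snd p $ 1 + c * snd p $ 2) =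
     expi (0 * fst p + ((- b / 2) * snd p $ 1 + (- c / 2) * snd p $ 2)) *
     (qpoch (expi (fst p)) (expi (0 * fst p + (b * snd p $ 1 + c * snd p $ 2))) *
      qpoch (expi (fst p)) (expi (1 * fst p + ((- b) * snd p $ 1 + (- c) * snd p $ 2))))"
    for p :: "complex \<times> (complex ^ 2)"
    unfolding theta_def
    by (intro arg_cong2[of _ _ _ _ "(*)"] arg_cong2[of _ _ _ _ qpoch] arg_cong[of _ _ expi])
       (simp_all add: field_simps)
  ultimately show ?thesis by (simp only:)
qed

lemma theta_vanishes_minus_iff:
  assumes "Im \<tau> > 0"
  shows "theta \<tau> (- z) = 0 \<longleftrightarrow> theta \<tau> z = 0"
proof -
  have "theta \<tau> (- z) = 0" if "theta \<tau> z = 0" for z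
  proof -
    obtain m n :: int where "z = of_int m * \<tau> + of_int n"
      using \<open>theta \<tau> z = 0\<close> theta_eq_0_iff[OF assms] by blast
    hence "- z = of_int (- m) * \<tau> + of_int (- n)" by simp
    thus ?thesis using theta_eq_0_iff[OF assms] by blast
  qed
  from this[of z] this[of "- z"] show ?thesis by auto
qed

text \<open>
  The theta quotient serves as the global representation. If its denominator vanished on a ball, then \<open>Im x\<close>
  would be an integral multiple of \<open>Im \<tau>\<close> throughout the ball; moving \<open>x\<close> by a small imaginary amount
  contradicts this.
\<close>

lemma meromorphic_elliptic_genus:
  "meromorphic_several_on (\<lambda>(\<tau>, w :: complex ^ 2). elliptic_genus_C2 \<tau> (w $ 1) (w $ 2)) jacobi_domain"
  unfolding meromorphic_several_on_def
proof (intro ballI exI conjI)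
  let ?U = "jacobi_domain :: (complex \<times> (complex ^ 2)) set"
  let ?th = "\<lambda>b c p :: complex \<times> (complex ^ 2). theta (fst p) (b * snd p $ 1 + c * snd p $ 2)"
  show "holomorphic_several_on (\<lambda>p. ?th 1 1 p * ?th 1 (- 1) p) ?U"
    and "holomorphic_several_on (\<lambda>p. ?th 0 1 p * ?th 0 (- 1) p) ?U"
    by (intro holomorphic_several_on_mult theta_holomorphic_several)+
  show "interior {p \<in> ?U. ?th 0 1 p * ?th 0 (- 1) p = 0} = {}"
  proof (rule ccontr)
    assume "interior {p \<in> ?U. ?th 0 1 p * ?th 0 (- 1) p = 0} \<noteq> {}"
    then obtain p where p: "p \<in> interior {p \<in> ?U. ?th 0 1 p * ?th 0 (- 1) p = 0}" by blast
    then obtain e where e: "e > 0" "ball p e \<subseteq> {p \<in> ?U. ?th 0 1 p * ?th 0 (- 1) p = 0}"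
      unfolding mem_interior by blast
    obtain \<tau> w where pw: "p = (\<tau>, w)" by fastforce
    have \<tau>: "Im \<tau> > 0" using subsetD[OF e(2), of p] e(1) by (auto simp: pw jacobi_domain_def)
    define \<delta> where "\<delta> = min (e / 2) (Im \<tau> / 2)"
    have \<delta>: "0 < \<delta>" "\<delta> < e" "\<delta> < Im \<tau>" using e(1) \<tau> by (auto simp: \<delta>_def)
    have Im_lattice: "\<exists>m :: int. Im (w' $ 2) = of_int m * Im \<tau>" if "(\<tau>, w') \<in> ball p e" for w'
    proof -
      have "theta \<tau> (w' $ 2) = 0"
        using subsetD[OF e(2) that] theta_vanishes_minus_iff[OF \<tau>] by auto
      then obtain m n :: int where "w' $ 2 = of_int m * \<tau> + of_int n"
        using theta_eq_0_iff[OF \<tau>] by blast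
      thus ?thesis by (intro exI[of _ m]) simp
    qed
    obtain m where m: "Im (w $ 2) = of_int m * Im \<tau>" using Im_lattice[of w] e(1) by (auto simp: pw)
    have "(\<tau>, w + axis 2 (\<i> * of_real \<delta>)) \<in> ball p e"
      using \<delta> by (simp add: pw dist_Pair_Pair dist_norm norm_vec_def L2_set_def axis_def sum_2 norm_mult)
    from Im_lattice[OF this] obtain m' where m': "Im (w $ 2) + \<delta> = of_int m' * Im \<tau>" by auto
    from m m' have "\<delta> = of_int (m' - m) * Im \<tau>" by (simp add: algebra_simps)
    with \<delta> \<tau> have "0 < real_of_int (m' - m)" "real_of_int (m' - m) < 1"
      by (auto simp: zero_less_mult_iff)
    hence "0 < m' - m" "m' - m < 1" by (simp_all only: of_int_0_less_iff of_int_less_1_iff)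
    thus False by simp
  qed
  fix x assume "x \<in> ?U" 
  thus "?th 0 1 x * ?th 0 (- 1) x \<noteq> 0 \<longrightarrow> (case x of (\<tau>, w) \<Rightarrow> elliptic_genus_C2 \<tau> (w $ 1) (w $ 2)) =
      ?th 1 1 x * ?th 1 (- 1) x / (?th 0 1 x * ?th 0 (- 1) x)"
    by (auto simp: jacobi_domain_def elliptic_genus_C2_eq_theta)
qed auto

section \<open>Euler's two expansions\<close>

lemma has_sum_mult_complex:
  fixes a :: "'a \<Rightarrow> complex" and b :: "'b \<Rightarrow> complex"
  assumes a: "(a has_sum A) I" and b: "(b has_sum B) J"
  shows "((\<lambda>(i, j). a i * b j) has_sum A * B) (I \<times> J)"
proof (rule has_sum_SigmaI)
  show "((\<lambda>j. case (i, j) of (i, j) \<Rightarrow> a i * b j) has_sum a i * B) J" for i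
    using has_sum_cmult_right[OF b, of "a i"] by simp
  show "((\<lambda>i. a i * B) has_sum A * B) I"
    by (rule has_sum_cmult_left[OF a])
  have na: "(\<lambda>i. norm (a i)) summable_on I" and nb: "(\<lambda>j. norm (b j)) summable_on J"
    using a b by (simp_all add: has_sum_imp_summable flip: summable_on_iff_abs_summable_on_complex)
  have "(\<lambda>p. norm (case p of (i, j) \<Rightarrow> a i * b j)) summable_on (I \<times> J)"
  proof (rule summable_on_SigmaI)
    show "((\<lambda>j. norm (case (i, j) of (i, j) \<Rightarrow> a i * b j)) has_sum
            norm (a i) * (\<Sum>\<^sub>\<infinity>j\<in>J. norm (b j))) J" for i
      using has_sum_cmult_right[OF has_sum_infsum[OF nb], of "norm (a i)"] by (simp add: norm_mult)
    show "(\<lambda>i. norm (a i) * (\<Sum>\<^sub>\<infinity>j\<in>J. norm (b j))) summable_on I"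
      by (rule summable_on_cmult_left[OF na])
  qed auto
  thus "(\<lambda>(i, j). a i * b j) summable_on (I \<times> J)"
    by (rule abs_summable_summable)
qed

text \<open>
  The finite \<open>q\<close>-Pochhammer symbol \<open>(q; q)\<^sub>n\<close>.
\<close>

definition qfac :: "nat \<Rightarrow> complex \<Rightarrow> complex" where
  "qfac n q = (\<Prod>k<n. 1 - q ^ Suc k)"

lemma qfac_Suc: "qfac (Suc n) q = qfac n q * (1 - q ^ Suc n)"
  by (simp add: qfac_def)

lemma one_minus_power_Suc_nonzero:
  fixes q :: complex
  assumes "norm q < 1"
  shows "1 - q ^ Suc k \<noteq> 0"
proof -
  have "norm (q ^ Suc k) \<le> norm q"
    using assms by (simp only: norm_power) (intro power_Suc_le_self, auto)
  thus ?thesis using assms by auto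
qed

lemma qfac_nonzero: "norm q < 1 \<Longrightarrow> qfac n q \<noteq> 0"
  using one_minus_power_Suc_nonzero by (auto simp: qfac_def)

text \<open>
  The number of partitions of \<open>m\<close> into parts of size at most \<open>n\<close>: the parts of size \<open>n + 1\<close> together
  contribute a multiple of \<open>n + 1\<close>. They are nonnegative, so a power series in \<open>q\<close> with these
  coefficients is dominated by its value at \<open>|q|\<close>.
\<close>

primrec partition_count :: "nat \<Rightarrow> nat \<Rightarrow> real" where
  "partition_count 0 m = (if m = 0 then 1 else 0)"
| "partition_count (Suc n) m =
     (\<Sum>i\<le>m. partition_count n i * (if Suc n dvd m - i then 1 else 0))"

lemma partition_count_nonneg: "partition_count n m \<ge> 0"
  by (induction n arbitrary: m) (auto intro!: sum_nonneg)

text \<open>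
  Passing from \<open>n\<close> to \<open>n + 1\<close> multiplies by the geometric series in \<open>q\<^bsup>n+1\<^esup>\<close>; its coefficients
  \<open>d\<close> are the indicator function of divisibility by \<open>n + 1\<close>.
\<close>

lemma inverse_qfac_sums:
  "norm q < 1 \<Longrightarrow> (\<lambda>m. of_real (partition_count n m) * q ^ m) sums (1 / qfac n q)"
proof (induction n arbitrary: q)
  case 0
  have eq: "(\<lambda>m. of_real (partition_count 0 m) * q ^ m) = (\<lambda>m. if m = 0 then 1 else 0)" by auto
  show ?case
    unfolding eq qfac_def using sums_single[of 0 "\<lambda>_. 1 :: complex"] by simp
next
  case (Suc n)
  note q = Suc.prems
  define p where "p = partition_count n"
  define d where "d j = (if Suc n dvd j then 1 else 0 :: real)" for j
  have p: "p m \<ge> 0" for m by (simp add: p_def partition_count_nonneg)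
  have psums: "(\<lambda>m. of_real (p m) * r ^ m) sums (1 / qfac n r)" if "norm r < 1" for r
    unfolding p_def by (rule Suc.IH[OF that])
  have sp: "summable (\<lambda>m. norm (of_real (p m) * q ^ m))"
  proof -
    have "summable (\<lambda>m. complex_of_real (p m) * complex_of_real (norm q) ^ m)"
      using psums[of "of_real (norm q)"] q by (auto simp: sums_iff)
    hence "summable (\<lambda>m. complex_of_real (p m * norm q ^ m))" by simp
    thus ?thesis using p by (simp only: summable_complex_of_real) (simp add: norm_mult norm_power)
  qed
  have sd: "summable (\<lambda>m. norm (of_real (d m) * q ^ m))"
  proof (rule summable_comparison_test')
    show "summable (\<lambda>m. norm q ^ m)" using q by (intro summable_geometric) auto
    show "norm (norm (of_real (d m) * q ^ m)) \<le> norm q ^ m" if "m \<ge> 0" for m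
      by (simp add: d_def norm_power)
  qed
  have "(\<lambda>m. of_real (d m) * q ^ m) sums (1 / (1 - q ^ Suc n))"
  proof -
    have "norm (q ^ Suc n) \<le> norm q"
      using q by (simp only: norm_power) (intro power_Suc_le_self, auto)
    hence "(\<lambda>k. (q ^ Suc n) ^ k) sums (1 / (1 - q ^ Suc n))"
      using q by (intro geometric_sums) linarith
    also have "(\<lambda>k. (q ^ Suc n) ^ k) = (\<lambda>k. of_real (d (Suc n * k)) * q ^ (Suc n * k))"
      by (simp add: d_def power_mult del: power_Suc mult_Suc)
    finally have geo: "(\<lambda>k. of_real (d (Suc n * k)) * q ^ (Suc n * k)) sums (1 / (1 - q ^ Suc n))" .
    have mono: "strict_mono (\<lambda>k. Suc n * k)"
    proof (rule strict_monoI)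
      show "Suc n * x < Suc n * y" if "x < y" for x y :: nat
        using that by (simp only: mult_less_cancel1) simp
    qed
    have zero: "of_real (d m) * q ^ m = 0" if "m \<notin> range (\<lambda>k. Suc n * k)" for m
    proof -
      have "\<not> Suc n dvd m" using that by (auto elim!: dvdE simp del: mult_Suc)
      thus ?thesis by (simp add: d_def)
    qed
    show ?thesis
      by (rule iffD1[OF sums_mono_reindex[OF mono zero] geo])
  qed
  hence conv: "(\<lambda>k. \<Sum>i\<le>k. (of_real (p i) * q ^ i) * (of_real (d (k - i)) * q ^ (k - i))) sums
      ((1 / qfac n q) * (1 / (1 - q ^ Suc n)))"
    using Cauchy_product_sums[OF sp sd] psums[OF q] by (simp add: sums_iff)
  have coeff: "(\<Sum>i\<le>k. (of_real (p i) * q ^ i) * (of_real (d (k - i)) * q ^ (k - i))) =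
      of_real (partition_count (Suc n) k) * q ^ k" for k
  proof -
    have "partition_count (Suc n) k = (\<Sum>i\<le>k. p i * d (k - i))" by (simp add: p_def d_def)
    hence "of_real (partition_count (Suc n) k) * q ^ k =
        (\<Sum>i\<le>k. of_real (p i * d (k - i)) * q ^ k)"
      by (simp only: of_real_sum sum_distrib_right)
    also have "\<dots> = (\<Sum>i\<le>k. (of_real (p i) * q ^ i) * (of_real (d (k - i)) * q ^ (k - i)))"
    proof (intro sum.cong refl)
      fix i assume "i \<in> {..k}"
      hence "q ^ k = q ^ i * q ^ (k - i)" by (simp flip: power_add)
      thus "of_real (p i * d (k - i)) * q ^ k =
          (of_real (p i) * q ^ i) * (of_real (d (k - i)) * q ^ (k - i))"
        by (simp only: of_real_mult mult_ac)
    qed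
    finally show ?thesis ..
  qed
  from conv show ?case
    by (simp only: coeff qfac_Suc times_divide_times_eq mult_1)
qed

text \<open>
  Euler's identities follow by iterating a functional equation that relates the values at \<open>u\<close> and \<open>uq\<close>;
  this is the limit at the end of the iteration.
\<close>

lemma power_series_tendsto_qpower:
  fixes c :: "nat \<Rightarrow> complex"
  assumes "norm q < 1" "norm u < norm K" "summable (\<lambda>n. c n * K ^ n)"
  shows "(\<lambda>N. \<Sum>n. c n * (u * q ^ N) ^ n) \<longlonglongrightarrow> c 0"
proof -
  have "0 < norm K" using assms(2) norm_ge_zero[of u] by linarith
  hence "isCont (\<lambda>x. \<Sum>n. c n * x ^ n) 0"
    by (intro isCont_powser[OF assms(3)]) simp
  moreover have "(\<lambda>N. u * q ^ N) \<longlonglongrightarrow> 0"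
    using tendsto_mult_right_zero[OF LIMSEQ_power_zero[OF assms(1)], of u] by simp
  ultimately have "(\<lambda>N. \<Sum>n. c n * (u * q ^ N) ^ n) \<longlonglongrightarrow> (\<Sum>n. c n * 0 ^ n)"
    by (rule isCont_tendsto_compose)
  thus ?thesis by simp
qed

lemma norm_one_minus_power_Suc:
  fixes q :: complex
  assumes "norm q < 1"
  shows "1 - norm q \<le> norm (1 - q ^ Suc n)"
proof -
  have "norm (q ^ Suc n) \<le> norm q"
    using assms by (simp only: norm_power) (intro power_Suc_le_self, auto)
  thus ?thesis using norm_triangle_ineq2[of 1 "q ^ Suc n"] by simp
qed

text \<open>
  The recursion of the coefficients means that the series satisfies \<open>F v = (1 - v) F (vq)\<close>. Iteration splits
  off the partial products of \<open>qpoch q u\<close>, and \<open>F (u q\<^sup>N)\<close> tends to \<open>F 0 = 1\<close>.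
\<close>

lemma euler_qpoch_sums:
  assumes q: "norm q < 1"
  shows "(\<lambda>n. (- 1) ^ n * q ^ (n choose 2) / qfac n q * u ^ n) sums qpoch q u"
proof -
  define c where "c n = (- 1) ^ n * q ^ (n choose 2) / qfac n q" for n
  have c_rec: "c (Suc n) * (1 - q ^ Suc n) = - (q ^ n * c n)" for n
  proof -
    have "Suc n choose 2 = (n choose 2) + n" by (simp add: numeral_2_eq_2)
    thus ?thesis using one_minus_power_Suc_nonzero[OF q, of n] qfac_nonzero[OF q, of n]
      by (simp add: c_def qfac_Suc power_add field_simps del: power_Suc) simp
  qed
  have summ: "summable (\<lambda>n. c n * v ^ n)" for v
  proof -
    have "(\<lambda>n. norm q ^ n * (norm v / (1 - norm q))) \<longlonglongrightarrow> 0"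
      using q by (intro tendsto_mult_left_zero LIMSEQ_power_zero) auto
    hence "eventually (\<lambda>n. norm q ^ n * (norm v / (1 - norm q)) < 1 / 2) sequentially"
      by (rule order_tendstoD) simp
    then obtain N where N: "\<And>n. n \<ge> N \<Longrightarrow> norm q ^ n * (norm v / (1 - norm q)) < 1 / 2"
      unfolding eventually_sequentially by blast
    show ?thesis
    proof (rule summable_ratio_test[of "1 / 2" N])
      fix n assume n: "n \<ge> N"
      have "c (Suc n) * v ^ Suc n = - (q ^ n * v / (1 - q ^ Suc n)) * (c n * v ^ n)"
      proof -
        have "- (q ^ n * v / (1 - q ^ Suc n)) * (c n * v ^ n) =
            (c (Suc n) * (1 - q ^ Suc n)) * v ^ Suc n / (1 - q ^ Suc n)"
          unfolding c_rec by simp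
        thus ?thesis using one_minus_power_Suc_nonzero[OF q, of n] by simp
      qed
      hence "norm (c (Suc n) * v ^ Suc n) = norm q ^ n * (norm v / norm (1 - q ^ Suc n)) * norm (c n * v ^ n)"
        by (simp add: norm_mult norm_divide norm_power del: power_Suc)
      also have "\<dots> \<le> norm q ^ n * (norm v / (1 - norm q)) * norm (c n * v ^ n)"
      proof -
        have "0 < norm (1 - q ^ Suc n) * (1 - norm q)"
          using q one_minus_power_Suc_nonzero[OF q, of n] by (intro mult_pos_pos) (auto simp del: power_Suc)
        thus ?thesis using norm_one_minus_power_Suc[OF q, of n]
          by (intro mult_right_mono mult_left_mono divide_left_mono) auto
      qed
      also have "\<dots> \<le> 1 / 2 * norm (c n * v ^ n)"
        using N[OF n] by (intro mult_right_mono) auto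
      finally show "norm (c (Suc n) * v ^ Suc n) \<le> 1 / 2 * norm (c n * v ^ n)" .
    qed simp
  qed
  define F where "F v = (\<Sum>n. c n * v ^ n)" for v
  have F: "(\<lambda>n. c n * v ^ n) sums F v" for v using summ[of v] by (simp add: F_def summable_sums)
  have F_rec: "F v = (1 - v) * F (v * q)" for v
  proof -
    have "(\<lambda>n. c n * v ^ n - c n * (v * q) ^ n) sums (F v - F (v * q))"
      by (intro sums_diff F)
    moreover have "(\<lambda>n. c n * v ^ n - c n * (v * q) ^ n) sums (0 + (- v) * F (v * q))"
    proof -
      have "(\<lambda>n. (- v) * (c n * (v * q) ^ n)) sums ((- v) * F (v * q))"
        by (intro sums_mult F)
      also have "(\<lambda>n. (- v) * (c n * (v * q) ^ n)) = (\<lambda>n. c (Suc n) * v ^ Suc n - c (Suc n) * (v * q) ^ Suc n)"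
      proof
        fix n
        have "c (Suc n) * v ^ Suc n - c (Suc n) * (v * q) ^ Suc n = (c (Suc n) * (1 - q ^ Suc n)) * v ^ Suc n"
          unfolding power_mult_distrib by (simp add: algebra_simps)
        thus "(- v) * (c n * (v * q) ^ n) = c (Suc n) * v ^ Suc n - c (Suc n) * (v * q) ^ Suc n"
          unfolding c_rec by (simp add: power_mult_distrib)
      qed
      finally have "(\<lambda>n. c n * v ^ n - c n * (v * q) ^ n) sums ((- v) * F (v * q) + (c 0 * v ^ 0 - c 0 * (v * q) ^ 0))"
        by (rule sums_Suc)
      thus ?thesis by simp
    qed
    ultimately have "F v - F (v * q) = (- v) * F (v * q)" using sums_unique2 by fastforce
    thus ?thesis by (simp add: algebra_simps)
  qed
  have "F u = (\<Prod>n<N. 1 - u * q ^ n) * F (u * q ^ N)" for N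
    by (induction N) (simp_all add: F_rec[of "u * q ^ _"] mult_ac)
  moreover have "(\<lambda>N. (\<Prod>n<N. 1 - u * q ^ n) * F (u * q ^ N)) \<longlonglongrightarrow> qpoch q u * c 0"
    unfolding F_def
    by (intro tendsto_mult has_prod_imp_tendsto' has_prod_qpoch[OF q]
        power_series_tendsto_qpower[OF q _ summ[of "of_real (norm u + 1)"]]) (simp del: of_real_add)
  ultimately have "F u = qpoch q u * c 0" by (simp add: LIMSEQ_const_iff)
  moreover have "c 0 = 1" by (simp add: c_def qfac_def binomial_eq_0)
  ultimately show ?thesis using F[of u] by (simp add: c_def)
qed

text \<open>
  Here the functional equation is \<open>F (vq) = (1 - v) F v\<close>, so that \<open>qpoch q u * F u = 1\<close> in the limit.
\<close>

lemma euler_inverse_qpoch_sums: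
  assumes q: "norm q < 1" and u: "norm u < 1"
  shows "(\<lambda>n. 1 / qfac n q * u ^ n) sums (1 / qpoch q u)"
proof -
  define c where "c n = 1 / qfac n q" for n
  have c_rec: "c (Suc n) * (1 - q ^ Suc n) = c n" for n
    using one_minus_power_Suc_nonzero[OF q, of n] by (simp add: c_def qfac_Suc)
  have summ: "summable (\<lambda>n. c n * v ^ n)" if v: "norm v < 1" for v
  proof -
    obtain r where r: "norm v < r" "r < 1" using v dense by blast
    have "(\<lambda>n. norm v / norm (1 - q * q ^ n)) \<longlonglongrightarrow> norm v / norm (1 - q * 0)"
      using q by (intro tendsto_intros LIMSEQ_power_zero) auto
    hence "eventually (\<lambda>n. norm v / norm (1 - q * q ^ n) < r) sequentially"
      using r by (intro order_tendstoD) auto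
    then obtain N where N: "\<And>n. n \<ge> N \<Longrightarrow> norm v / norm (1 - q * q ^ n) < r"
      unfolding eventually_sequentially by blast
    show ?thesis
    proof (rule summable_ratio_test[of r N])
      fix n assume n: "n \<ge> N"
      have "c (Suc n) * v ^ Suc n = (v / (1 - q ^ Suc n)) * (c n * v ^ n)"
        unfolding c_rec[of n, symmetric] using one_minus_power_Suc_nonzero[OF q, of n] by simp
      hence "norm (c (Suc n) * v ^ Suc n) = norm v / norm (1 - q * q ^ n) * norm (c n * v ^ n)"
        by (simp add: norm_mult norm_divide)
      also have "\<dots> \<le> r * norm (c n * v ^ n)"
        using N[OF n] by (intro mult_right_mono) auto
      finally show "norm (c (Suc n) * v ^ Suc n) \<le> r * norm (c n * v ^ n)" .
    qed (use r in auto)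
  qed
  define F where "F v = (\<Sum>n. c n * v ^ n)" for v
  have F: "(\<lambda>n. c n * v ^ n) sums F v" if "norm v < 1" for v
    using summ[OF that] by (simp add: F_def summable_sums)
  have small: "norm (v * q ^ N) < 1" if "norm v < 1" for v N
  proof -
    have "norm v * norm q ^ N \<le> norm v * 1"
      using q by (intro mult_left_mono power_le_one) auto
    thus ?thesis using that by (simp add: norm_mult norm_power)
  qed
  have F_rec: "F (v * q) = (1 - v) * F v" if v: "norm v < 1" for v
  proof -
    note F1 = F[OF v] and F2 = F[OF small[OF v, of 1, simplified]]
    have "(\<lambda>n. c n * v ^ n - c n * (v * q) ^ n) sums (F v - F (v * q))"
      by (intro sums_diff F1 F2)
    moreover have "(\<lambda>n. c n * v ^ n - c n * (v * q) ^ n) sums (0 + v * F v)"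
    proof -
      have "(\<lambda>n. v * (c n * v ^ n)) sums (v * F v)"
        by (intro sums_mult F1)
      also have "(\<lambda>n. v * (c n * v ^ n)) = (\<lambda>n. c (Suc n) * v ^ Suc n - c (Suc n) * (v * q) ^ Suc n)"
      proof
        fix n
        have "c (Suc n) * v ^ Suc n - c (Suc n) * (v * q) ^ Suc n = (c (Suc n) * (1 - q ^ Suc n)) * v ^ Suc n"
          unfolding power_mult_distrib by (simp add: algebra_simps)
        thus "v * (c n * v ^ n) = c (Suc n) * v ^ Suc n - c (Suc n) * (v * q) ^ Suc n"
          unfolding c_rec by simp
      qed
      finally have "(\<lambda>n. c n * v ^ n - c n * (v * q) ^ n) sums (v * F v + (c 0 * v ^ 0 - c 0 * (v * q) ^ 0))"
        by (rule sums_Suc)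
      thus ?thesis by simp
    qed
    ultimately have "F v - F (v * q) = v * F v" using sums_unique2 by fastforce
    thus ?thesis by (simp add: algebra_simps)
  qed
  have "F (u * q ^ N) = (\<Prod>n<N. 1 - u * q ^ n) * F u" for N
    using F_rec[OF small[OF u]] by (induction N) (simp_all add: mult_ac)
  moreover have "(\<lambda>N. (\<Prod>n<N. 1 - u * q ^ n) * F u) \<longlonglongrightarrow> qpoch q u * F u"
    by (intro tendsto_mult has_prod_imp_tendsto' has_prod_qpoch[OF q] tendsto_const)
  moreover obtain K where K: "norm u < K" "K < 1" using u dense by blast
  have "(\<lambda>N. F (u * q ^ N)) \<longlonglongrightarrow> c 0"
    unfolding F_def
    by (rule power_series_tendsto_qpower[OF q _ summ[of "of_real K"]])
       (use K norm_ge_zero[of u] in \<open>simp_all del: norm_ge_zero\<close>)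
  ultimately have "qpoch q u * F u = c 0" by (simp add: LIMSEQ_unique)
  hence "qpoch q u * F u = 1" by (simp add: c_def qfac_def)
  hence "F u = 1 / qpoch q u" by (metis mult_zero_left nonzero_mult_div_cancel_left zero_neq_one)
  thus ?thesis using F[OF u] by (simp add: c_def)
qed

text \<open>
  Expanding each \<open>1 / qfac n q\<close> in powers of \<open>q\<close> turns Euler's series into double series. Since all
  coefficients are nonnegative up to the sign \<open>s n\<close>, the sum of the absolute values is Euler's series at
  \<open>|q|\<close> and \<open>|u|\<close>, hence finite; so the double series converges unconditionally, and summing over
  \<open>m\<close> first identifies its value.
\<close>

lemma qfac_double_series:
  fixes e :: "nat \<Rightarrow> nat" and s :: "nat \<Rightarrow> complex"
  assumes q: "norm q < 1" and s: "\<And>n. norm (s n) = 1"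
    and S: "(\<lambda>n. s n * q ^ e n / qfac n q * u ^ n) sums S"
    and summ: "summable (\<lambda>n. of_real (norm q) ^ e n / qfac n (of_real (norm q)) * of_real (norm u) ^ n)"
  shows "((\<lambda>(n, m). (s n * of_real (partition_count n m)) * (q ^ (m + e n) * u ^ n)) has_sum S) UNIV"
proof -
  define p where "p = partition_count"
  have p: "p n m \<ge> 0" for n m by (simp add: p_def partition_count_nonneg)
  have psums: "(\<lambda>m. of_real (p n m) * r ^ m) sums (1 / qfac n r)" if "norm r < 1" for n r
    unfolding p_def by (rule inverse_qfac_sums[OF that])
  let ?f = "\<lambda>(n, m). (s n * of_real (p n m)) * (q ^ (m + e n) * u ^ n)"
  define G where "G n = (\<Sum>m. p n m * norm q ^ m)" for n
  have G: "(\<lambda>m. p n m * norm q ^ m) sums G n" "of_real (G n) = 1 / qfac n (of_real (norm q))" for n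
  proof -
    have *: "(\<lambda>m. complex_of_real (p n m * norm q ^ m)) sums (1 / qfac n (of_real (norm q)))"
      using psums[of "of_real (norm q)" n] q by simp
    hence "summable (\<lambda>m. complex_of_real (p n m * norm q ^ m))" by (rule sums_summable)
    hence "summable (\<lambda>m. p n m * norm q ^ m)" by (simp only: summable_complex_of_real)
    thus 1: "(\<lambda>m. p n m * norm q ^ m) sums G n" by (simp add: G_def summable_sums)
    have "(\<lambda>m. complex_of_real (p n m * norm q ^ m)) sums of_real (G n)"
      using 1 by (rule sums_of_real)
    with * show "of_real (G n) = 1 / qfac n (of_real (norm q))" by (rule sums_unique2[rotated])
  qed
  have Gnonneg: "G n \<ge> 0" for n using sums_le[OF _ sums_zero G(1)] p by simp
  have "(\<lambda>x. norm (?f x)) summable_on (SIGMA n:UNIV. UNIV)"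
  proof (rule summable_on_SigmaI)
    fix n
    have "((\<lambda>m. p n m * norm q ^ m) has_sum G n) UNIV"
      by (rule sums_nonneg_imp_has_sum[OF G(1)]) (simp add: p)
    from has_sum_cmult_left[OF this, of "norm q ^ e n * norm u ^ n"]
    show "((\<lambda>m. norm (?f (n, m))) has_sum (G n * (norm q ^ e n * norm u ^ n))) UNIV"
      by (simp add: norm_mult norm_power s p power_add mult_ac)
  next
    have "summable (\<lambda>n. complex_of_real (G n * (norm q ^ e n * norm u ^ n)))"
      using summ by (simp add: G(2) mult_ac)
    hence "summable (\<lambda>n. G n * (norm q ^ e n * norm u ^ n))" by (simp only: summable_complex_of_real)
    thus "(\<lambda>n. G n * (norm q ^ e n * norm u ^ n)) summable_on UNIV"
      by (rule summable_nonneg_imp_summable_on) (simp add: Gnonneg)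
  qed auto
  hence "?f summable_on UNIV" by (simp add: abs_summable_summable)
  then obtain S' where S': "(?f has_sum S') UNIV" by (auto simp: summable_on_def)
  have "((\<lambda>n. s n * q ^ e n / qfac n q * u ^ n) has_sum S') UNIV"
  proof (rule has_sum_SigmaD)
    show "(?f has_sum S') (SIGMA n:UNIV. UNIV)" using S' by simp
    fix n
    have "summable (\<lambda>m. norm (of_real (p n m) * q ^ m))"
      using G(1)[of n] by (simp add: norm_mult norm_power p sums_summable)
    hence "((\<lambda>m. of_real (p n m) * q ^ m) has_sum (1 / qfac n q)) UNIV"
      by (rule norm_summable_imp_has_sum) (rule psums[OF q])
    from has_sum_cmult_left[OF this, of "s n * q ^ e n * u ^ n"]
    show "((\<lambda>m. ?f (n, m)) has_sum (s n * q ^ e n / qfac n q * u ^ n)) UNIV"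
      by (simp add: power_add mult_ac)
  qed
  from has_sum_imp_sums[OF this] have "S' = S" using S by (rule sums_unique2)
  with S' show ?thesis by (simp add: p_def)
qed

text \<open>
  The alternating sign of Euler's series is absorbed by evaluating it at \<open>-|u|\<close>, which gives the majorant.
\<close>

lemma qpoch_double_series:
  assumes q: "norm q < 1"
  shows "((\<lambda>(n, m). ((- 1) ^ n * of_real (partition_count n m)) *
            (q ^ (m + (n choose 2)) * u ^ n)) has_sum qpoch q u) UNIV"
proof (rule qfac_double_series[where s = "\<lambda>n. (- 1) ^ n" and e = "\<lambda>n. n choose 2"])
  have "norm (complex_of_real (norm q)) < 1" using q by simp
  note sums_summable[OF euler_qpoch_sums[OF this, of "- of_real (norm u)"]]
  also have "(\<lambda>n. (- 1) ^ n * of_real (norm q) ^ (n choose 2) / qfac n (of_real (norm q)) * (- of_real (norm u)) ^ n) =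
     (\<lambda>n. complex_of_real (norm q) ^ (n choose 2) / qfac n (of_real (norm q)) * of_real (norm u) ^ n)"
  proof
    fix n
    have "(- 1) ^ n * a / b * (- d) ^ n = a / b * d ^ n" for a b d :: complex
    proof -
      have "(- 1) ^ n * (- d) ^ n = d ^ n" by (simp flip: power_mult_distrib)
      moreover have "(- 1) ^ n * a / b * (- d) ^ n = a / b * ((- 1) ^ n * (- d) ^ n)" by simp
      ultimately show ?thesis by (simp only:)
    qed
    thus "(- 1) ^ n * of_real (norm q) ^ (n choose 2) / qfac n (of_real (norm q)) * (- of_real (norm u)) ^ n =
      complex_of_real (norm q) ^ (n choose 2) / qfac n (of_real (norm q)) * of_real (norm u) ^ n" .
  qed
  finally show "summable (\<lambda>n. of_real (norm q) ^ (n choose 2) / qfac n (of_real (norm q)) * of_real (norm u) ^ n)" .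
  show "norm ((- 1) ^ n :: complex) = 1" for n by (simp add: norm_power)
qed (fact q, fact euler_qpoch_sums[OF q])

lemma inverse_qpoch_double_series:
  assumes q: "norm q < 1" and u: "norm u < 1"
  shows "((\<lambda>(n, m). of_real (partition_count n m) * (q ^ m * u ^ n)) has_sum (1 / qpoch q u)) UNIV"
proof -
  have "((\<lambda>(n, m). (1 * of_real (partition_count n m)) * (q ^ (m + 0) * u ^ n)) has_sum (1 / qpoch q u)) UNIV"
  proof (rule qfac_double_series[OF q, where s = "\<lambda>_. 1" and e = "\<lambda>_. 0"])
    show "(\<lambda>n. 1 * q ^ 0 / qfac n q * u ^ n) sums (1 / qpoch q u)"
      using euler_inverse_qpoch_sums[OF q u] by simp
    have "norm (complex_of_real (norm q)) < 1" "norm (complex_of_real (norm u)) < 1"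
      using q u by simp_all
    from sums_summable[OF euler_inverse_qpoch_sums[OF this]]
    show "summable (\<lambda>n. of_real (norm q) ^ 0 / qfac n (of_real (norm q)) * of_real (norm u) ^ n)"
      by simp
  qed simp
  thus ?thesis by simp
qed

section \<open>Functions with a Fourier expansion\<close>

definition fourier_monomial :: "complex \<times> (complex ^ 'r) \<Rightarrow> nat \<times> (int ^ 'r) \<Rightarrow> complex" where
  "fourier_monomial p v = expi (fst p) ^ fst v * (\<Prod>i\<in>UNIV. expi (snd p $ i) powi (snd v $ i))"

lemma fourier_monomial_nonzero [simp]: "fourier_monomial p v \<noteq> 0"
  by (simp add: fourier_monomial_def)

lemma fourier_monomial_mult:
  "fourier_monomial p v * fourier_monomial p w = fourier_monomial p (fst v + fst w, snd v + snd w)"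
  by (simp add: fourier_monomial_def power_add power_int_add prod.distrib mult_ac)

lemma fourier_monomial_power:
  "fourier_monomial p v ^ n = fourier_monomial p (n * fst v, \<chi> i. int n * snd v $ i)"
proof -
  have 1: "(z powi k) ^ n = z powi (int n * k)" for z :: complex and k
    by (metis mult.commute power_int_mult power_int_of_nat)
  have 2: "(z ^ k) ^ n = z ^ (n * k)" for z :: complex and k
    by (metis mult.commute power_mult)
  show ?thesis
    by (simp only: fourier_monomial_def power_mult_distrib prod_power_distrib 1 2 fst_conv snd_conv vec_lambda_beta)
qed

lemma fourier_monomial_q: "expi (fst p) ^ m = fourier_monomial p (m, 0)"
  by (simp add: fourier_monomial_def)

text \<open>
  The existence of a Fourier expansion without the conditions on the region; the pair \<open>(n, \<gamma>)\<close> is kept as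
  one index.
\<close>

definition expandable_on ::
  "(complex \<times> (complex ^ 'r)) set \<Rightarrow> (complex \<times> (complex ^ 'r) \<Rightarrow> complex) \<Rightarrow> bool" where
  "expandable_on R f \<longleftrightarrow>
     (\<exists>c. \<forall>p\<in>R. ((\<lambda>v. c v * fourier_monomial p v) has_sum f p) UNIV)"

text \<open>
  A sum of monomials over any index set can be regrouped by exponents. All terms of a group are multiples of the
  same nonvanishing monomial, so the coefficients in the group are summable by themselves, and their sum does not
  depend on the point \<open>p\<close>.
\<close>

lemma expandable_onI:
  fixes g :: "'i \<Rightarrow> nat \<times> (int ^ 'r)"
  assumes "\<And>p. p \<in> R \<Longrightarrow> ((\<lambda>i. k i * fourier_monomial p (g i)) has_sum f p) I"
  shows "expandable_on R f"
proof -
  define c where "c v = infsum k {i \<in> I. g i = v}" for v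
  have "((\<lambda>v. c v * fourier_monomial p v) has_sum f p) UNIV" if p: "p \<in> R" for p
  proof (rule has_sum_SigmaD)
    have "((\<lambda>i. k i * fourier_monomial p (g i)) has_sum f p) I \<longleftrightarrow>
      ((\<lambda>(v, i). k i * fourier_monomial p v) has_sum f p) (SIGMA v:UNIV. {i \<in> I. g i = v})"
      by (rule has_sum_reindex_bij_witness[of _ snd "\<lambda>i. (g i, i)"]) auto
    with assms[OF p] show "((\<lambda>(v, i). k i * fourier_monomial p v) has_sum f p) (SIGMA v:UNIV. {i \<in> I. g i = v})"
      by simp
    fix v
    have "(\<lambda>i. k i * fourier_monomial p (g i)) summable_on {i \<in> I. g i = v}"
      by (rule summable_on_subset_banach[OF has_sum_imp_summable[OF assms[OF p]]]) auto
    also have "?this \<longleftrightarrow> (\<lambda>i. k i * fourier_monomial p v) summable_on {i \<in> I. g i = v}"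
      by (rule summable_on_cong) auto
    finally have "k summable_on {i \<in> I. g i = v}"
      by (simp add: summable_on_cmult_left')
    hence "(k has_sum c v) {i \<in> I. g i = v}" by (simp add: c_def)
    from has_sum_cmult_left[OF this, of "fourier_monomial p v"]
    show "((\<lambda>i. case (v, i) of (v, i) \<Rightarrow> k i * fourier_monomial p v) has_sum c v * fourier_monomial p v) {i \<in> I. g i = v}"
      by simp
  qed
  thus ?thesis unfolding expandable_on_def by blast
qed

lemma expandable_on_cong:
  assumes "expandable_on R f" "\<And>p. p \<in> R \<Longrightarrow> f p = f' p"
  shows "expandable_on R f'"
  using assms by (simp add: expandable_on_def)

lemma expandable_on_monomial: "expandable_on R (\<lambda>p. c * fourier_monomial p v)"
  by (rule expandable_onI[where I = "{()}" and k = "\<lambda>_. c" and g = "\<lambda>_. v"])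
     (auto intro: has_sum_finiteI)

lemma expandable_on_mult:
  assumes "expandable_on R f" "expandable_on R g"
  shows "expandable_on R (\<lambda>p. f p * g p)"
proof -
  obtain a where a: "\<And>p. p \<in> R \<Longrightarrow> ((\<lambda>v. a v * fourier_monomial p v) has_sum f p) UNIV"
    using assms(1) unfolding expandable_on_def by blast
  obtain b where b: "\<And>p. p \<in> R \<Longrightarrow> ((\<lambda>v. b v * fourier_monomial p v) has_sum g p) UNIV"
    using assms(2) unfolding expandable_on_def by blast
  show ?thesis
  proof (rule expandable_onI)
    fix p assume p: "p \<in> R"
    have "((\<lambda>(v, w). (a v * fourier_monomial p v) * (b w * fourier_monomial p w)) has_sum f p * g p) (UNIV \<times> UNIV)"
      by (rule has_sum_mult_complex[OF a[OF p] b[OF p]])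
    also have "(\<lambda>(v, w). (a v * fourier_monomial p v) * (b w * fourier_monomial p w)) =
      (\<lambda>vw. (a (fst vw) * b (snd vw)) * fourier_monomial p
          (fst (fst vw) + fst (snd vw), snd (fst vw) + snd (snd vw)))"
      unfolding fourier_monomial_mult[symmetric] by (auto simp: mult_ac)
    finally show "((\<lambda>vw. (a (fst vw) * b (snd vw)) * fourier_monomial p
          (fst (fst vw) + fst (snd vw), snd (fst vw) + snd (snd vw))) has_sum f p * g p) (UNIV \<times> UNIV)" .
  qed
qed

text \<open>
  A power of a monomial is a monomial, so the double series is a Fourier expansion after the substitution.
\<close>

lemma expandable_on_qpoch:
  assumes R: "R \<subseteq> jacobi_domain"
  shows "expandable_on R (\<lambda>p. qpoch (expi (fst p)) (fourier_monomial p v))"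
proof -
  define c :: "nat \<times> nat \<Rightarrow> complex"
    where "c = (\<lambda>(n, m). (- 1) ^ n * of_real (partition_count n m))"
  have c: "((\<lambda>(n, m). c (n, m) * (q ^ (m + (n choose 2)) * u ^ n)) has_sum qpoch q u) UNIV"
    if "norm q < 1" for q u
    using qpoch_double_series[OF that] by (simp add: c_def)
  show ?thesis
  proof (rule expandable_onI)
    fix p assume "p \<in> R"
    with R have "norm (expi (fst p)) < 1" by (auto simp: jacobi_domain_def)
    from c[OF this, of "fourier_monomial p v"]
    have "((\<lambda>(n, m). c (n, m) * (expi (fst p) ^ (m + (n choose 2)) * fourier_monomial p v ^ n))
        has_sum qpoch (expi (fst p)) (fourier_monomial p v)) UNIV" .
    also have "(\<lambda>(n, m). c (n, m) * (expi (fst p) ^ (m + (n choose 2)) * fourier_monomial p v ^ n)) =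
      (\<lambda>nm. c nm * fourier_monomial p (snd nm + (fst nm choose 2) + fst nm * fst v, \<chi> i. int (fst nm) * snd v $ i))"
      by (auto simp: fourier_monomial_power fourier_monomial_q fourier_monomial_mult)
    finally show "((\<lambda>nm. c nm * fourier_monomial p (snd nm + (fst nm choose 2) + fst nm * fst v, \<chi> i. int (fst nm) * snd v $ i))
        has_sum qpoch (expi (fst p)) (fourier_monomial p v)) UNIV" .
  qed
qed

lemma expandable_on_inverse_qpoch:
  assumes R: "R \<subseteq> jacobi_domain" and small: "\<And>p. p \<in> R \<Longrightarrow> norm (fourier_monomial p v) < 1"
  shows "expandable_on R (\<lambda>p. 1 / qpoch (expi (fst p)) (fourier_monomial p v))"
proof -
  define c :: "nat \<times> nat \<Rightarrow> complex" where "c = (\<lambda>(n, m). of_real (partition_count n m))"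
  have c: "((\<lambda>(n, m). c (n, m) * (q ^ m * u ^ n)) has_sum (1 / qpoch q u)) UNIV"
    if "norm q < 1" "norm u < 1" for q u
    using inverse_qpoch_double_series[OF that] by (simp add: c_def)
  show ?thesis
  proof (rule expandable_onI)
    fix p assume p: "p \<in> R"
    with R have "norm (expi (fst p)) < 1" by (auto simp: jacobi_domain_def)
    from c[OF this small[OF p]]
    have "((\<lambda>(n, m). c (n, m) * (expi (fst p) ^ m * fourier_monomial p v ^ n))
        has_sum 1 / qpoch (expi (fst p)) (fourier_monomial p v)) UNIV" .
    also have "(\<lambda>(n, m). c (n, m) * (expi (fst p) ^ m * fourier_monomial p v ^ n)) =
      (\<lambda>nm. c nm * fourier_monomial p (snd nm + fst nm * fst v, \<chi> i. int (fst nm) * snd v $ i))"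
      by (auto simp: fourier_monomial_power fourier_monomial_q fourier_monomial_mult)
    finally show "((\<lambda>nm. c nm * fourier_monomial p (snd nm + fst nm * fst v, \<chi> i. int (fst nm) * snd v $ i))
        has_sum 1 / qpoch (expi (fst p)) (fourier_monomial p v)) UNIV" .
  qed
qed

section \<open>The Fourier expansion of the elliptic genus\<close>

lemma fourier_monomial_2:
  "fourier_monomial (p :: complex \<times> (complex ^ 2)) (n, vector [a, b]) =
     expi (fst p) ^ n * (expi (snd p $ 1) powi a * expi (snd p $ 2) powi b)"
  by (simp add: fourier_monomial_def UNIV_2)

lemma expansion_region_alt:
  "expansion_region = {p. 0 < Im (snd p $ 2) \<and> Im (snd p $ 2) < Im (fst p)}"
proof -
  have 1: "exp (- 2 * pi * s) < exp (- 2 * pi * t) \<longleftrightarrow> t < s" for s t :: real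
    by (simp add: mult_less_0_iff)
  have 2: "exp (- 2 * pi * t) < 1 \<longleftrightarrow> 0 < t" for t :: real
    using 1[of t 0] by simp
  show ?thesis
    unfolding expansion_region_def expi_def[symmetric] norm_expi 1 2 by auto
qed

text \<open>
  The factor \<open>E(1/t)\<close> of the denominator is not in the range of Euler's second identity. Replacing it by
  \<open>(1 - 1/t) E(q/t)\<close>, and \<open>E(qt)\<close> by \<open>E(t) / (1 - t)\<close>, turns the denominator into
  \<open>-t\<^sup>-\<^sup>1 E(t)\<^sup>2 E(q/t)\<^sup>2\<close>.
\<close>

lemma elliptic_genus_expandable:
  "expandable_on expansion_region (\<lambda>p. elliptic_genus_C2 (fst p) (snd p $ 1) (snd p $ 2))"
proof -
  let ?R = "expansion_region"
  have R: "?R \<subseteq> jacobi_domain" by (auto simp: expansion_region_alt jacobi_domain_def)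
  let ?N = "\<lambda>n a b p. qpoch (expi (fst p)) (fourier_monomial p (n, vector [a, b]))"
  let ?D = "\<lambda>n a b p. 1 / qpoch (expi (fst p)) (fourier_monomial p (n, vector [a, b]))"
  have N: "expandable_on ?R (?N n a b)" for n a b
    by (rule expandable_on_qpoch[OF R])
  have D1: "expandable_on ?R (?D 0 0 1)"
    by (rule expandable_on_inverse_qpoch[OF R])
       (auto simp: fourier_monomial_2 expansion_region_alt norm_expi)
  have D2: "expandable_on ?R (?D 1 0 (- 1))"
  proof (rule expandable_on_inverse_qpoch[OF R])
    fix p assume "p \<in> ?R"
    hence "Im (fst p - snd p $ 2) > 0" by (simp add: expansion_region_alt)
    hence "norm (expi (fst p - snd p $ 2)) < 1" by (rule norm_expi_less_1)
    thus "norm (fourier_monomial p (1, vector [0, - 1])) < 1"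
      by (simp add: fourier_monomial_2 expi_diff power_int_minus field_simps)
  qed
  have "expandable_on ?R (\<lambda>p. ((- 1) * fourier_monomial p (0, vector [- 1, 1])) *
     ((?N 0 1 1 p * ?N 1 (- 1) (- 1) p) * (?N 0 1 (- 1) p * ?N 1 (- 1) 1 p)) *
     ((?D 0 0 1 p * ?D 0 0 1 p) * (?D 1 0 (- 1) p * ?D 1 0 (- 1) p)))"
    by (intro expandable_on_mult N D1 D2 expandable_on_monomial)
  thus ?thesis
  proof (rule expandable_on_cong)
    fix p assume p: "p \<in> ?R"
    define q y t where "q = expi (fst p)" and "y = expi (snd p $ 1)" and "t = expi (snd p $ 2)"
    have im: "Im (fst p) > 0" using p by (simp add: expansion_region_alt)
    hence q: "norm q < 1" by (simp add: q_def)
    have nz: "y \<noteq> 0" "t \<noteq> 0" by (simp_all add: y_def t_def)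
    have "norm t < 1" using p by (auto simp: t_def expansion_region_alt)
    hence t1: "t \<noteq> 1" by auto
    have e1: "qpoch q (inverse t) = (1 - inverse t) * qpoch q (q * inverse t)"
      using qpoch_rec[OF q, of "inverse t"] by (simp add: mult_ac)
    have e2: "qpoch q (q * t) = qpoch q t / (1 - t)"
      using qpoch_rec[OF q, of t] t1 by (simp add: mult_ac)
    have "elliptic_genus_C2 (fst p) (snd p $ 1) (snd p $ 2) = inverse y *
      ((qpoch q (y * t) * qpoch q (inverse y * q * inverse t) * qpoch q (y * inverse t) * qpoch q (inverse y * q * t)) /
       (qpoch q t * qpoch q (q * inverse t) * ((1 - inverse t) * qpoch q (q * inverse t)) * (qpoch q t / (1 - t))))"
      unfolding elliptic_genus_C2_eq_qpoch[OF im] q_def[symmetric] y_def[symmetric] t_def[symmetric]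
      unfolding e1 e2 ..
    also have "\<dots> = (- (t / y)) *
       ((qpoch q (y * t) * qpoch q (inverse y * q * inverse t)) * (qpoch q (y * inverse t) * qpoch q (inverse y * q * t))) *
       ((1 / qpoch q t * (1 / qpoch q t)) * (1 / qpoch q (q * inverse t) * (1 / qpoch q (q * inverse t))))"
    proof -
      have *: "1 - inverse t = - ((1 - t) / t)" using nz by (simp add: field_simps)
      have "1 - t \<noteq> 0" using t1 by simp
      thus ?thesis unfolding * using nz by (simp add: divide_simps) 
    qed
    finally show "((- 1) * fourier_monomial p (0, vector [- 1, 1])) *
     ((?N 0 1 1 p * ?N 1 (- 1) (- 1) p) * (?N 0 1 (- 1) p * ?N 1 (- 1) 1 p)) *
     ((?D 0 0 1 p * ?D 0 0 1 p) * (?D 1 0 (- 1) p * ?D 1 0 (- 1) p)) =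
      elliptic_genus_C2 (fst p) (snd p $ 1) (snd p $ 2)"
      by (simp add: fourier_monomial_2 power_int_minus q_def y_def t_def field_simps)
  qed
qed

text \<open>
  In logarithmic coordinates the region is \<open>0 < Im x < Im \<tau>\<close>, which is convex, hence connected.
\<close>

lemma fourier_expansion_elliptic_genus:
  "fourier_expansion_on expansion_region (\<lambda>(\<tau>, w). elliptic_genus_C2 \<tau> (w $ 1) (w $ 2))"
  unfolding fourier_expansion_on_def
proof (intro conjI)
  show "open expansion_region"
    unfolding expansion_region_alt
    by (intro open_Collect_conj open_Collect_less continuous_intros)
  show "connected expansion_region"
  proof (rule convex_connected, rule convexI)
    fix p p' :: "complex \<times> (complex ^ 2)" and u v :: real
    assume p: "p \<in> expansion_region" "p' \<in> expansion_region" and uv: "0 \<le> u" "0 \<le> v" "u + v = 1"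
    have comb: "0 < u * a + v * b" if "0 < a" "0 < b" for a b :: real
      using that uv by (metis add_nonneg_pos add_pos_nonneg add.right_neutral less_eq_real_def mult_nonneg_nonneg mult_pos_pos zero_less_one)
    show "u *\<^sub>R p + v *\<^sub>R p' \<in> expansion_region"
      using p comb[of "Im (snd p $ 2)" "Im (snd p' $ 2)"]
        comb[of "Im (fst p) - Im (snd p $ 2)" "Im (fst p') - Im (snd p' $ 2)"]
      by (simp add: expansion_region_alt algebra_simps)
  qed
  have "(2 * \<i>, \<chi> i. \<i>) \<in> expansion_region" by (simp add: expansion_region_alt)
  thus "expansion_region \<noteq> {}" by blast
  show "expansion_region \<subseteq> jacobi_domain" by (auto simp: expansion_region_alt jacobi_domain_def)
  obtain c where c: "\<And>p. p \<in> expansion_region \<Longrightarrow>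
     ((\<lambda>v. c v * fourier_monomial p v) has_sum elliptic_genus_C2 (fst p) (snd p $ 1) (snd p $ 2)) UNIV"
    using elliptic_genus_expandable unfolding expandable_on_def by blast
  show "\<exists>c :: nat \<Rightarrow> int ^ 2 \<Rightarrow> complex. \<forall>(\<tau>, w) \<in> expansion_region.
        ((\<lambda>(n, \<gamma>). c n \<gamma> * exp (2 * of_real pi * \<i> * \<tau>) ^ n
            * (\<Prod>i\<in>UNIV. exp (2 * of_real pi * \<i> * w $ i) powi (\<gamma> $ i)))
          has_sum (case (\<tau>, w) of (\<tau>, w) \<Rightarrow> elliptic_genus_C2 \<tau> (w $ 1) (w $ 2))) UNIV"
    by (intro exI[of _ "\<lambda>n \<gamma>. c (n, \<gamma>)"])
       (use c in \<open>simp add: fourier_monomial_def expi_def case_prod_unfold mult.assoc\<close>)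
qed

theorem proposition7p1p1:
  shows "weak_jacobi_form 0 (vector [vector [1, 0], vector [0, 0]] :: rat ^ 2 ^ 2)
           expansion_region
           (\<lambda>(\<tau>, w). elliptic_genus_C2 \<tau> (w $ 1) (w $ 2))"
  unfolding weak_jacobi_form_def
  using jacobi_index_genus_index meromorphic_elliptic_genus modular_law_elliptic_genus
    elliptic_law_elliptic_genus fourier_expansion_elliptic_genus
  by blast

end
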